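(* Let $B\in\mathbb{R}^{m\times n}$, $P\in\mathbb{R}^{q\times n}$, $b\in\mathbb{R}^m$, let $C\subseteq\mathbb{R}^q$ be a solid pointed polyhedral convex cone, and let $c\in\operatorname{int}C$ with $c_q=1$. Let $S=\{x\in\mathbb{R}^n\mid Bx\ge b\}\neq\emptyset$ and assume that the polyhedral cone $\mathcal{P}^h=P[S^h]+C$, where $S^h=\{x\in\mathbb{R}^n\mid Bx\ge 0\}$, has a vertex. Then Algorithm 2 (described in the context), with input a solution $(\{0\},\bar S^h)$ to (P$^h$) and a solution $\bar T^h$ to (D$^{*h}$), is correct and finite. That is, every step can be carried out, the algorithm terminates after finitely many steps, and upon termination: $(\bar S,\bar S^h)$ is a solution to (P); $\bar T$ is a solution to (D$^*$); $(\mathcal{T}_{points},\mathcal{T}_{dirs})$ is a V-representation of the upper image $\mathcal{P}=P[S]+C$; and $(\mathcal{T}^*_{points},\{-e^q\})$ is a V-representation of the lower image $\mathcal{D}^*$. This holds both with and without the optional break command.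
   Context: Notation. $y\le_C y'$ means $y'-y\in C$. Solid means having nonempty interior; pointed means containing no lines. $e^q$ is the $q$-th unit vector. $Y$ is a matrix whose columns generate $C$. $P[A]=\{Px\mid x\in A\}$. $\operatorname{cone}\emptyset=\{0\}$. A pair $(A_{points},A_{dirs})$ of finite sets of points and directions is a V-representation of a polyhedron $A$ if $A=\operatorname{conv}A_{points}+\operatorname{cone}A_{dirs}$ (not necessarily minimal). Primal problem (P): minimize $Px$ with respect to $\le_C$ subject to $x\in S$. Its homogeneous problem (P$^h$) is the same problem with $b$ replaced by $0$ (feasible set $S^h$). A point $\bar x\in S$ is a minimizer of (P) if there is no $x\in S$ with $Px\le_C P\bar x$ and $Px\ne P\bar x$. A direction $k\in S^h\setminus\{0\}$ is a minimizer for (P) if the point $k$ is a minimizer of (P$^h$). A pair $(\bar S,\bar S^h)$ with $\bar S\subseteq S$ nonempty finite and $\bar S^h\subseteq S^h\setminus\{0\}$ finite (possibly empty) is a finite infimizer if $\operatorname{conv}P[\bar S]+\operatorname{cone}P[\bar S^h]+C=P[S]+C$. A finite infimizer is a solution to (P) if $\bar S$ and $\bar S^h$ consist only of minimizers. The same definitions apply to (P$^h$), i.e. with $b=0$. Dual problem (D$^*$): maximize $D^*(u,w)=(w_1,\dots,w_{q-1},b^Tu)^T$ with respect to $\le_K$, $K=\mathbb{R}_+\cdot e^q$, over $$T=\{(u,w)\in\mathbb{R}^m\times\mathbb{R}^q\mid u\ge 0,\ B^Tu=P^Tw,\ c^Tw=1,\ Y^Tw\ge 0\}.$$ (D$^{*h}$)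 is the same problem with objective $D^{*h}(u,w)=(w_1,\dots,w_{q-1},0)^T$ (same feasible set $T$). A point $(\bar u,\bar w)\in T$ is a maximizer of (D$^*$) if there is no $(u,w)\in T$ with $D^*(u,w)\ge_K D^*(\bar u,\bar w)$ and $D^*(u,w)\neq D^*(\bar u,\bar w)$. A nonempty finite $\bar T\subseteq T$ is a finite supremizer if $\operatorname{conv}D^*[\bar T]-K=D^*[T]-K$; it is a solution to (D$^*$) if in addition it consists only of maximizers. The same definitions apply to (D$^{*h}$) with $D^{*h}$ in place of $D^*$. The lower image is $\mathcal{D}^*=D^*[T]-K$. For $y,y^*\in\mathbb{R}^q$: $w(y^* )=\bigl(y_1^*,\dots,y_{q-1}^*,1-\sum_{i=1}^{q-1}c_iy_i^*\bigr)^T$ and $\varphi(y,y^* )=w(y^* )^Ty-y^*_q$. Linear programs: (P$_1(w)$): $\min w^TPx$ s.t. $Bx\ge b$. (D$_1(w)$): $\max b^Tu$ s.t. $B^Tu=P^Tw$, $u\ge 0$. The routine solve() returns (arbitrary) optimal solutions: solve(P$_1(w)$) returns an optimal solution $x$ of (P$_1(w)$); solve(P$_1(w)$/D$_1(w)$) returns an optimal solution $x$ of (P$_1(w)$) and an optimal solution $u$ of (D$_1(w)$). The routine dual$(\mathcal{T}_{points},\mathcal{T}_{dirs})$: with $\mathcal{T}=\operatorname{conv}\mathcal{T}_{points}+\operatorname{cone}\mathcal{T}_{dirs}$, it returns a (not necessarily minimal) V-representation of $\mathcal{T}^*=\{y^*\in\mathbb{R}^q\mid\varphi(y,y^* )\ge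 0\text{ for all }y\in\mathcal{T}\}$; the recession cone of $\mathcal{T}^*$ is always $-K=\operatorname{cone}\{-e^q\}$, so only the point part $\mathcal{T}^*_{points}$ is kept and $\mathcal{T}^*=\operatorname{conv}\mathcal{T}^*_{points}+\operatorname{cone}\{-e^q\}$. Algorithm 2. Input: the data $B,b,P,Y$ of (P), a solution $(\{0\},\bar S^h)$ to (P$^h$), a solution $\bar T^h$ to (D$^{*h}$). Step 0: $\mathcal{T}_{dirs}\leftarrow\{Px\mid x\in\bar S^h\}\cup\{y\mid y\text{ is a column of }Y\}$; $\bar w\leftarrow$ the arithmetic mean of $\{w\mid(u,w)\in\bar T^h\}$; $\bar S\leftarrow\{\mathrm{solve}(\mathrm{P}_1(\bar w))\}$. Repeat the following until $flag=0$ at the end of a pass: (i) $flag\leftarrow 0$; $\bar T\leftarrow\emptyset$; $\mathcal{T}_{points}\leftarrow\{Px\mid x\in\bar S\}$; $\mathcal{T}^*_{points}\leftarrow$ point part of $\mathrm{dual}(\mathcal{T}_{points},\mathcal{T}_{dirs})$. (ii) For each $t^*\in\mathcal{T}^*_{points}$ in turn: $w\leftarrow w(t^* )$; $(x,u)\leftarrow\mathrm{solve}(\mathrm{P}_1(w)/\mathrm{D}_1(w))$; if $t^*_q-b^Tu>0$, set $\bar S\leftarrow\bar S\cup\{x\}$, $flag\leftarrow1$, and (optionally) break, i.e. exit the for-loop; otherwise set $\bar T\leftarrow\bar T\cup\{(u,w)\}$. Final step (after the repeat loop): delete from $\bar S$ all points $x$ for which $Px$ is not a vertex of $\mathcal{T}=\operatorname{conv}\mathcal{T}_{points}+\operatorname{cone}\mathcal{T}_{dirs}$.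 Output: $(\bar S,\bar S^h)$, $\bar T$, $(\mathcal{T}_{points},\mathcal{T}_{dirs})$, $(\mathcal{T}^*_{points},\{-e^q\})$. *)

theory Defs
  imports "HOL-Analysis.Analysis"
begin

text \<open>
  Conventions. Index types play the role of the dimensions: \<open>B :: real^'n^'m\<close>,
  \<open>P :: real^'n^'q\<close>, and \<open>Y :: real^'p^'q\<close> has the generators of \<open>C\<close> as its columns. The
  distinguished last coordinate of \<open>\<real>\<^sup>q\<close> is an index \<open>l :: 'q\<close>, so that \<open>axis l 1\<close> is the
  unit vector \<open>e\<^sup>q\<close>; the numbering of the other coordinates is immaterial. The order on
  \<open>real^'m\<close> is componentwise. On sets, \<open>+\<close> is the Minkowski sum, but \<open>-\<close> is the set difference,
  whence the separate \<open>minkowski_diff\<close>. The homogeneous problems are obtained by taking \<open>0\<close> for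
  \<open>b\<close>.
\<close>

definition contains_line :: "'a::real_vector set \<Rightarrow> bool" where
  "contains_line A \<longleftrightarrow> (\<exists>a d. d \<noteq> 0 \<and> (\<forall>t::real. a + t *\<^sub>R d \<in> A))"

definition cone_le :: "'a::real_vector set \<Rightarrow> 'a \<Rightarrow> 'a \<Rightarrow> bool" where
  "cone_le C y y' \<longleftrightarrow> y' - y \<in> C"

definition minkowski_diff :: "'a::real_vector set \<Rightarrow> 'a set \<Rightarrow> 'a set" where
  "minkowski_diff A K = {a - k | a k. a \<in> A \<and> k \<in> K}"

text \<open>Here \<open>convex_cone hull {} = {0}\<close>.\<close>

definition is_vrep :: "'a::real_vector set \<Rightarrow> 'a set \<Rightarrow> 'a set \<Rightarrow> bool" where
  "is_vrep A pts dirs \<longleftrightarrow>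
     finite pts \<and> finite dirs \<and> A = convex hull pts + convex_cone hull dirs"

subsection \<open>Primal problem\<close>

definition feasible :: "real^'n^'m \<Rightarrow> real^'m \<Rightarrow> (real^'n) set" where
  "feasible B b = {x. b \<le> B *v x}"

definition upper_image ::
  "real^'n^'m \<Rightarrow> real^'m \<Rightarrow> real^'n^'q \<Rightarrow> (real^'q) set \<Rightarrow> (real^'q) set" where
  "upper_image B b P C = (\<lambda>x. P *v x) ` feasible B b + C"

definition point_minimizer ::
  "real^'n^'m \<Rightarrow> real^'m \<Rightarrow> real^'n^'q \<Rightarrow> (real^'q) set \<Rightarrow> real^'n \<Rightarrow> bool" where
  "point_minimizer B b P C x \<longleftrightarrow> x \<in> feasible B b \<and>
     \<not> (\<exists>x'\<in>feasible B b. cone_le C (P *v x') (P *v x) \<and> P *v x' \<noteq> P *v x)"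

definition direction_minimizer ::
  "real^'n^'m \<Rightarrow> real^'n^'q \<Rightarrow> (real^'q) set \<Rightarrow> real^'n \<Rightarrow> bool" where
  "direction_minimizer B P C k \<longleftrightarrow> k \<in> feasible B 0 - {0} \<and> point_minimizer B 0 P C k"

definition finite_infimizer ::
  "real^'n^'m \<Rightarrow> real^'m \<Rightarrow> real^'n^'q \<Rightarrow> (real^'q) set \<Rightarrow>
     (real^'n) set \<Rightarrow> (real^'n) set \<Rightarrow> bool" where
  "finite_infimizer B b P C S Sh \<longleftrightarrow>
     S \<noteq> {} \<and> finite S \<and> S \<subseteq> feasible B b \<and>
     finite Sh \<and> Sh \<subseteq> feasible B 0 - {0} \<and>
     convex hull ((\<lambda>x. P *v x) ` S) + convex_cone hull ((\<lambda>x. P *v x) ` Sh) + C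
       = upper_image B b P C"

definition primal_solution ::
  "real^'n^'m \<Rightarrow> real^'m \<Rightarrow> real^'n^'q \<Rightarrow> (real^'q) set \<Rightarrow>
     (real^'n) set \<Rightarrow> (real^'n) set \<Rightarrow> bool" where
  "primal_solution B b P C S Sh \<longleftrightarrow> finite_infimizer B b P C S Sh \<and>
     (\<forall>x\<in>S. point_minimizer B b P C x) \<and> (\<forall>k\<in>Sh. direction_minimizer B P C k)"

subsection \<open>Dual problem\<close>

definition dual_feasible ::
  "real^'n^'m \<Rightarrow> real^'n^'q \<Rightarrow> real^'p^'q \<Rightarrow> real^'q \<Rightarrow> ((real^'m) \<times> (real^'q)) set" where
  "dual_feasible B P Y c =
     {(u, w). 0 \<le> u \<and> transpose B *v u = transpose P *v w \<and> c \<bullet> w = 1 \<and> 0 \<le> transpose Y *v w}"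

definition dual_cone_K :: "'q \<Rightarrow> (real^'q) set" where
  "dual_cone_K l = {r *\<^sub>R axis l 1 | r. 0 \<le> r}"

text \<open>For \<open>b = 0\<close> this is the objective \<open>D\<^sup>*\<^sup>h\<close> of the homogeneous dual problem, since the
  feasible set of the dual problem does not depend on \<open>b\<close>.\<close>

definition dual_obj :: "'q \<Rightarrow> real^'m \<Rightarrow> (real^'m) \<times> (real^'q) \<Rightarrow> real^'q" where
  "dual_obj l b = (\<lambda>(u, w). \<chi> i. if i = l then b \<bullet> u else w $ i)"

definition lower_image ::
  "'q \<Rightarrow> real^'n^'m \<Rightarrow> real^'m \<Rightarrow> real^'n^'q \<Rightarrow> real^'p^'q \<Rightarrow> real^'q \<Rightarrow> (real^'q) set" where
  "lower_image l B b P Y c =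
     minkowski_diff (dual_obj l b ` dual_feasible B P Y c) (dual_cone_K l)"

definition dual_maximizer ::
  "'q \<Rightarrow> real^'n^'m \<Rightarrow> real^'m \<Rightarrow> real^'n^'q \<Rightarrow> real^'p^'q \<Rightarrow> real^'q \<Rightarrow>
     (real^'m) \<times> (real^'q) \<Rightarrow> bool" where
  "dual_maximizer l B b P Y c t \<longleftrightarrow> t \<in> dual_feasible B P Y c \<and>
     \<not> (\<exists>t'\<in>dual_feasible B P Y c.
          cone_le (dual_cone_K l) (dual_obj l b t) (dual_obj l b t') \<and>
          dual_obj l b t' \<noteq> dual_obj l b t)"

definition finite_supremizer ::
  "'q \<Rightarrow> real^'n^'m \<Rightarrow> real^'m \<Rightarrow> real^'n^'q \<Rightarrow> real^'p^'q \<Rightarrow> real^'q \<Rightarrow>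
     ((real^'m) \<times> (real^'q)) set \<Rightarrow> bool" where
  "finite_supremizer l B b P Y c Tb \<longleftrightarrow>
     Tb \<noteq> {} \<and> finite Tb \<and> Tb \<subseteq> dual_feasible B P Y c \<and>
     minkowski_diff (convex hull (dual_obj l b ` Tb)) (dual_cone_K l) = lower_image l B b P Y c"

definition dual_solution ::
  "'q \<Rightarrow> real^'n^'m \<Rightarrow> real^'m \<Rightarrow> real^'n^'q \<Rightarrow> real^'p^'q \<Rightarrow> real^'q \<Rightarrow>
     ((real^'m) \<times> (real^'q)) set \<Rightarrow> bool" where
  "dual_solution l B b P Y c Tb \<longleftrightarrow> finite_supremizer l B b P Y c Tb \<and>
     (\<forall>t\<in>Tb. dual_maximizer l B b P Y c t)"

subsection \<open>Coupling function and subroutines\<close>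

definition wvec :: "'q \<Rightarrow> real^'q \<Rightarrow> real^'q \<Rightarrow> real^'q" where
  "wvec l c ys = (\<chi> i. if i = l then 1 - (\<Sum>j\<in>UNIV - {l}. c $ j * ys $ j) else ys $ i)"

definition coupling :: "'q \<Rightarrow> real^'q \<Rightarrow> real^'q \<Rightarrow> real^'q \<Rightarrow> real" where
  "coupling l c y ys = wvec l c ys \<bullet> y - ys $ l"

definition dual_polyhedron :: "'q \<Rightarrow> real^'q \<Rightarrow> (real^'q) set \<Rightarrow> (real^'q) set" where
  "dual_polyhedron l c A = {ys. \<forall>y\<in>A. 0 \<le> coupling l c y ys}"

text \<open>The admissible results of the routine \<open>dual\<close>: point parts of arbitrary V-representations.\<close>

definition dual_result ::
  "'q \<Rightarrow> real^'q \<Rightarrow> (real^'q) set \<Rightarrow> (real^'q) set \<Rightarrow> (real^'q) set \<Rightarrow> bool" where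
  "dual_result l c Tp Td Tsp \<longleftrightarrow>
     (\<exists>dirs. is_vrep (dual_polyhedron l c (convex hull Tp + convex_cone hull Td)) Tsp dirs)"

definition opt_P1 :: "real^'n^'m \<Rightarrow> real^'m \<Rightarrow> real^'n^'q \<Rightarrow> real^'q \<Rightarrow> real^'n \<Rightarrow> bool" where
  "opt_P1 B b P w x \<longleftrightarrow> x \<in> feasible B b \<and>
     (\<forall>x'\<in>feasible B b. w \<bullet> (P *v x) \<le> w \<bullet> (P *v x'))"

definition opt_D1 :: "real^'n^'m \<Rightarrow> real^'m \<Rightarrow> real^'n^'q \<Rightarrow> real^'q \<Rightarrow> real^'m \<Rightarrow> bool" where
  "opt_D1 B b P w u \<longleftrightarrow>
     transpose B *v u = transpose P *v w \<and> 0 \<le> u \<and>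
     (\<forall>u'. transpose B *v u' = transpose P *v w \<and> 0 \<le> u' \<longrightarrow> b \<bullet> u' \<le> b \<bullet> u)"

subsection \<open>The algorithm\<close>

definition T_dirs :: "real^'n^'q \<Rightarrow> real^'p^'q \<Rightarrow> (real^'n) set \<Rightarrow> (real^'q) set" where
  "T_dirs P Y Sh = (\<lambda>x. P *v x) ` Sh \<union> columns Y"

definition mean_w :: "((real^'m) \<times> (real^'q)) set \<Rightarrow> real^'q" where
  "mean_w Th = (1 / real (card (snd ` Th))) *\<^sub>R (\<Sum>w\<in>snd ` Th. w)"

text \<open>
  The algorithm is a nondeterministic transition system, the choices being the results of
  \<open>solve\<close> and \<open>dual\<close> and the order in which the for-loop runs through its finite set.
  Control states: \<open>Init\<close> is the start, \<open>Pass S\<close> the beginning of a pass of the repeat loop,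
  \<open>Loop S Tb Tp Tsp ts flag\<close> the for-loop with the list \<open>ts\<close> of elements of \<open>Tsp\<close> that are still
  to be processed (in this order), and \<open>Done S Tb Tp Tsp\<close> the end. The arguments are the
  current values of the variables: \<open>S\<close> and \<open>Tb\<close> are the approximate primal and dual solutions,
  \<open>Tp\<close> and \<open>Tsp\<close> the points of the inner approximation and of its dual.
\<close>

datatype ('x, 't, 'y) alg_state =
    Init
  | Pass "'x set"
  | Loop "'x set" "'t set" "'y set" "'y set" "'y list" bool
  | Done "'x set" "'t set" "'y set" "'y set"

text \<open>The parameter \<open>brk\<close> tells whether the optional break command is present.\<close>

inductive alg2_step ::
  "bool \<Rightarrow> 'q \<Rightarrow> real^'n^'m \<Rightarrow> real^'m \<Rightarrow> real^'n^'q \<Rightarrow> real^'p^'q \<Rightarrow> real^'q \<Rightarrow>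
     (real^'n) set \<Rightarrow> ((real^'m) \<times> (real^'q)) set \<Rightarrow>
     (real^'n, (real^'m) \<times> (real^'q), real^'q) alg_state \<Rightarrow>
     (real^'n, (real^'m) \<times> (real^'q), real^'q) alg_state \<Rightarrow> bool"
  for brk l B b P Y c Sh Th
where
  init: "opt_P1 B b P (mean_w Th) x \<Longrightarrow>
    alg2_step brk l B b P Y c Sh Th Init (Pass {x})"
| begin_pass: "dual_result l c ((\<lambda>x. P *v x) ` S) (T_dirs P Y Sh) Tsp \<Longrightarrow>
    distinct ts \<Longrightarrow> set ts = Tsp \<Longrightarrow>
    alg2_step brk l B b P Y c Sh Th
      (Pass S) (Loop S {} ((\<lambda>x. P *v x) ` S) Tsp ts False)"
| improve: "opt_P1 B b P (wvec l c t) x \<Longrightarrow> opt_D1 B b P (wvec l c t) u \<Longrightarrow>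
    t $ l - b \<bullet> u > 0 \<Longrightarrow>
    alg2_step brk l B b P Y c Sh Th
      (Loop S Tb Tp Tsp (t # ts) flag)
      (Loop (insert x S) Tb Tp Tsp (if brk then [] else ts) True)"
| keep: "opt_P1 B b P (wvec l c t) x \<Longrightarrow> opt_D1 B b P (wvec l c t) u \<Longrightarrow>
    \<not> t $ l - b \<bullet> u > 0 \<Longrightarrow>
    alg2_step brk l B b P Y c Sh Th
      (Loop S Tb Tp Tsp (t # ts) flag)
      (Loop S (insert (u, wvec l c t) Tb) Tp Tsp ts flag)"
| repeat_pass: "alg2_step brk l B b P Y c Sh Th (Loop S Tb Tp Tsp [] True) (Pass S)"
| finish: "alg2_step brk l B b P Y c Sh Th
    (Loop S Tb Tp Tsp [] False)
    (Done {x \<in> S. (P *v x) extreme_point_of (convex hull Tp + convex_cone hull T_dirs P Y Sh)}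
       Tb Tp Tsp)"

end

theory Submission
  imports Defs
begin

text \<open>
  LP duality gives the value of the scalarizations, and a point \<open>t\<close> belongs to the lower image exactly
  if \<open>t\<^sub>q\<close> is at most the optimal value for \<open>w(t)\<close>. Since the inner approximation \<open>T\<close> is contained
  in the upper image, its dual contains the lower image. After a pass without improvement all points
  generating the dual of \<open>T\<close> lie in the lower image, so both duals coincide, and a separation argument
  shows that \<open>T\<close> is the upper image.

  Termination: in an improving pass, every known point \<open>x'\<close> satisfies
  \<open>w(t) \<bullet> P x' \<ge> t\<^sub>q > min w(t) \<bullet> P x\<close>, so the optimal face of the program for \<open>w(t)\<close>, a face of
  the feasible set, contains no known point but contains the new one. The feasible set has only
  finitely many faces.
\<close>

subsection \<open>Linear programming duality\<close>

text \<open>The directions are settled by the input: the cone \<open>K\<close> generated by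
  \<open>Td\<close> equals the homogeneous upper image, so a run only has to find points. As the
  vertex assumption makes \<open>K\<close> pointed, deleting non-vertices at the end loses nothing.
  The choice of \<open>c\<close> in the interior of \<open>C\<close> bounds the vectors
  \<open>w\<close> with \<open>c \<bullet> w = 1\<close> that are nonnegative on \<open>K\<close>.
  Hence a dual polyhedron can recede only along -e^q, and a separating normal can be scaled to have
  the form w(t). The obstacle is the freedom of the subroutines. \<open>dual\<close> may return
  redundant points and any directions, and \<open>solve\<close> any optimal solution, not
  necessarily a vertex. Therefore only optimal values enter the comparison with
  \<open>t $ l\<close>, and faces of the feasible set are counted instead of vertices. Without the
  break, later points of a pass are still tested against the outdated \<open>Tp\<close>. Only the
  first improvement of a pass is sure to meet a new face, which is why the termination measure is
  lexicographic.\<close>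

lemma convex_cone_hull_range:
  fixes f :: "'i::finite \<Rightarrow> 'a::real_vector"
  shows "convex_cone hull (range f) = {\<Sum>i\<in>UNIV. u i *\<^sub>R f i | u. \<forall>i. 0 \<le> u i}" (is "?L = ?R")
proof
  show "?L \<subseteq> ?R"
  proof (rule hull_minimal)
    show "range f \<subseteq> ?R"
    proof clarify
      fix j
      have "f j = (\<Sum>i\<in>UNIV. (if i = j then 1 else 0) *\<^sub>R f i)"
        by (simp add: if_distrib [of "\<lambda>r. r *\<^sub>R _"] cong: if_cong)
      then show "\<exists>u. f j = (\<Sum>i\<in>UNIV. u i *\<^sub>R f i) \<and> (\<forall>i. 0 \<le> u i)"
        by (intro exI [of _ "\<lambda>i. if i = j then 1 else 0"]) simp
    qed
    show "convex_cone ?R"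
      unfolding convex_cone_iff
    proof (intro conjI ballI allI impI)
      show "0 \<in> ?R"
        by (auto intro!: exI [of _ "\<lambda>i. 0"])
    next
      fix x y assume "x \<in> ?R" "y \<in> ?R"
      then obtain u v where "x = (\<Sum>i\<in>UNIV. u i *\<^sub>R f i)" "\<forall>i. 0 \<le> u i"
        "y = (\<Sum>i\<in>UNIV. v i *\<^sub>R f i)" "\<forall>i. 0 \<le> v i"
        by auto
      then show "x + y \<in> ?R"
        by (auto intro!: exI [of _ "\<lambda>i. u i + v i"] simp: scaleR_add_left sum.distrib)
    next
      fix x and r :: real assume "x \<in> ?R" "0 \<le> r"
      then obtain u where "x = (\<Sum>i\<in>UNIV. u i *\<^sub>R f i)" "\<forall>i. 0 \<le> u i"
        by auto
      with \<open>0 \<le> r\<close> show "r *\<^sub>R x \<in> ?R"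
        by (auto intro!: exI [of _ "\<lambda>i. r * u i"] simp: scaleR_sum_right)
    qed
  qed
  show "?R \<subseteq> ?L"
  proof clarify
    fix u :: "'i \<Rightarrow> real" assume u: "\<forall>i. 0 \<le> u i"
    have "(\<Sum>i\<in>J. u i *\<^sub>R f i) \<in> ?L" if "finite J" for J
      using that
    proof induction
      case empty
      then show ?case by (simp add: convex_cone_hull_contains_0)
    next
      case (insert j J)
      have "u j *\<^sub>R f j \<in> ?L"
        using u by (intro convex_cone_hull_mul hull_inc) auto
      with insert show ?case
        by (simp add: convex_cone_hull_add)
    qed
    then show "(\<Sum>i\<in>UNIV. u i *\<^sub>R f i) \<in> ?L"
      by simp
  qed
qed

lemma separating_closed_convex_cone_point:
  fixes K :: "'a::euclidean_space set"
  assumes "convex_cone K" "closed K" "z \<notin> K"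
  obtains y where "\<And>k. k \<in> K \<Longrightarrow> 0 \<le> y \<bullet> k" "y \<bullet> z < 0"
proof -
  obtain y r where y: "y \<bullet> z < r" "\<And>k. k \<in> K \<Longrightarrow> r < y \<bullet> k"
    using separating_hyperplane_closed_point [of K z] assms by (auto simp: convex_cone_def)
  have "r < 0"
    using y(2) [OF convex_cone_contains_0 [OF assms(1)]] by simp
  have "0 \<le> y \<bullet> k" if "k \<in> K" for k
  proof (rule ccontr)
    assume "\<not> 0 \<le> y \<bullet> k"
    then have neg: "y \<bullet> k < 0" by simp
    \<comment> \<open>Scaling by this nonnegative factor moves \<open>k\<close> exactly to level
      \<open>r\<close>, which the strict separation forbids.\<close>
    have "(r / (y \<bullet> k)) *\<^sub>R k \<in> K"
      using \<open>r < 0\<close> neg by (intro convex_cone_scaleR [OF assms(1) _ that]) (simp add: divide_nonpos_neg)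
    from y(2) [OF this] neg show False
      by simp
  qed
  moreover have "y \<bullet> z < 0"
    using y(1) \<open>r < 0\<close> by simp
  ultimately show ?thesis ..
qed

text \<open>A finitely generated cone is closed, so a point outside it can be separated from it. The
  case-rule form lets each application choose its own target and generators.\<close>

lemma farkas_cone:
  fixes f :: "'i::finite \<Rightarrow> 'a::euclidean_space"
  obtains u where "\<And>i. 0 \<le> u i" "z = (\<Sum>i\<in>UNIV. u i *\<^sub>R f i)"
    | y where "\<And>i. 0 \<le> y \<bullet> f i" "y \<bullet> z < 0"
proof (cases "z \<in> convex_cone hull (range f)")
  case True
  then show ?thesis
    using that(1) by (auto simp: convex_cone_hull_range)
next
  case False
  then obtain y where "\<And>k. k \<in> convex_cone hull (range f) \<Longrightarrow> 0 \<le> y \<bullet> k" "y \<bullet> z < 0"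
    using separating_closed_convex_cone_point [OF convex_cone_convex_cone_hull closed_convex_cone_hull]
    by (metis finite_class.finite_UNIV finite_imageI)
  then show ?thesis
    by (intro that(2)) (auto intro: hull_inc)
qed

text \<open>Farkas for the target (0, 1) and the lifted rows \<open>(a i, \<beta> i)\<close>: a
  combination is the certificate of infeasibility, while a separator (x, t) has t < 0, and -x/t
  solves the system.\<close>

lemma gale_alternative:
  fixes a :: "'i::finite \<Rightarrow> 'a::euclidean_space" and \<beta> :: "'i \<Rightarrow> real"
  obtains x where "\<And>i. \<beta> i \<le> a i \<bullet> x"
    | u where "\<And>i. 0 \<le> u i" "(\<Sum>i\<in>UNIV. u i *\<^sub>R a i) = 0" "(\<Sum>i\<in>UNIV. u i * \<beta> i) = 1"
proof (rule farkas_cone [of "(0::'a, 1::real)" "\<lambda>i. (a i, \<beta> i)"])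
  fix u :: "'i \<Rightarrow> real"
  assume "\<And>i. 0 \<le> u i" and eq: "(0::'a, 1) = (\<Sum>i\<in>UNIV. u i *\<^sub>R (a i, \<beta> i))"
  moreover have "(\<Sum>i\<in>UNIV. u i *\<^sub>R a i) = 0"
    using arg_cong [OF eq, of fst] by (simp add: fst_sum)
  moreover have "(\<Sum>i\<in>UNIV. u i * \<beta> i) = 1"
    using arg_cong [OF eq, of snd] by (simp add: snd_sum)
  ultimately show thesis
    using that(2) by blast
next
  fix y :: "'a \<times> real"
  assume *: "\<And>i. 0 \<le> y \<bullet> (a i, \<beta> i)" "y \<bullet> (0, 1) < 0"
  obtain x t where y: "y = (x, t)" by fastforce
  with * have "t < 0" and "\<And>i. 0 \<le> x \<bullet> a i + t * \<beta> i"
    by auto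
  then have "\<beta> i \<le> a i \<bullet> ((- 1 / t) *\<^sub>R x)" for i
    by (simp add: field_simps inner_commute) (smt (verit) mult.commute)
  then show thesis
    using that(1) by blast
qed

text \<open>Boundedness of the primal problem is expressed through the recession directions \<open>k\<close> of its
  feasible set.\<close>

lemma lp_strong_duality:
  fixes a :: "'i::finite \<Rightarrow> 'a::euclidean_space" and \<beta> :: "'i \<Rightarrow> real"
  assumes feas: "\<And>i. \<beta> i \<le> a i \<bullet> x0"
    and bdd: "\<And>k. (\<And>i. 0 \<le> a i \<bullet> k) \<Longrightarrow> 0 \<le> d \<bullet> k"
  obtains x u where "\<And>i. \<beta> i \<le> a i \<bullet> x" "\<And>i. 0 \<le> u i" "(\<Sum>i\<in>UNIV. u i *\<^sub>R a i) = d"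
    "d \<bullet> x = (\<Sum>i\<in>UNIV. u i * \<beta> i)"
proof -
  let ?X = "{x. \<forall>i. \<beta> i \<le> a i \<bullet> x}"
  have weak: "(\<Sum>i\<in>UNIV. u i * \<beta> i) \<le> (\<Sum>i\<in>UNIV. u i *\<^sub>R a i) \<bullet> x"
    if "\<And>i. 0 \<le> u i" "x \<in> ?X" for u x
    using that by (auto simp: inner_sum_left intro!: sum_mono mult_left_mono)
  \<comment> \<open>A dual feasible point, obtained from boundedness along recession directions. By
    weak duality it makes the infimum \<open>p\<close> finite.\<close>
  obtain u0 where u0: "\<And>i. 0 \<le> u0 i" "d = (\<Sum>i\<in>UNIV. u0 i *\<^sub>R a i)"
  proof (rule farkas_cone [of d a])
    fix y assume "\<And>i. 0 \<le> y \<bullet> a i" "y \<bullet> d < 0"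
    then show ?thesis
      using bdd [of y] by (auto simp: inner_commute)
  qed (use that in auto)
  define p where "p = (INF x\<in>?X. d \<bullet> x)"
  have p_le: "p \<le> d \<bullet> x" if "x \<in> ?X" for x
    unfolding p_def using weak [OF u0(1)] that unfolding u0(2)
    by (intro cINF_lower) (auto intro!: bdd_belowI2)
  have p_ge: "r \<le> p" if "\<And>x. x \<in> ?X \<Longrightarrow> r \<le> d \<bullet> x" for r
    unfolding p_def using feas that by (intro cINF_greatest) auto
  \<comment> \<open>The extra generator (0, -1) at \<open>None\<close> is a slack: representing (d,
    p) then yields a dual value of at least \<open>p\<close> instead of exactly
    \<open>p\<close>.\<close>
  define f where "f = case_option (0, -1) (\<lambda>i. (a i, \<beta> i))"
  obtain u where u: "\<And>i. 0 \<le> u i" "(\<Sum>i\<in>UNIV. u i *\<^sub>R a i) = d" "p \<le> (\<Sum>i\<in>UNIV. u i * \<beta> i)"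
  proof (rule farkas_cone [of "(d, p)" f])
    fix v :: "'i option \<Rightarrow> real"
    assume v: "\<And>j. 0 \<le> v j" and eq: "(d, p) = (\<Sum>j\<in>UNIV. v j *\<^sub>R f j)"
    have "(\<Sum>i\<in>UNIV. v (Some i) *\<^sub>R a i) = d"
      using arg_cong [OF eq, of fst] by (simp add: f_def UNIV_option_conv sum.reindex fst_sum)
    moreover have "p = (\<Sum>i\<in>UNIV. v (Some i) * \<beta> i) - v None"
      using arg_cong [OF eq, of snd] by (simp add: f_def UNIV_option_conv sum.reindex snd_sum)
    ultimately show ?thesis
      using that [of "\<lambda>i. v (Some i)"] v [of None] v by auto
  next
    fix y assume *: "\<And>j. 0 \<le> y \<bullet> f j" "y \<bullet> (d, p) < 0"
    obtain x t where y: "y = (x, t)" by fastforce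
    have t: "t \<le> 0" and x: "\<And>i. 0 \<le> a i \<bullet> x + t * \<beta> i" and neg: "d \<bullet> x + t * p < 0"
      using *(1) [of None] *(1) [of "Some _"] *(2) unfolding y f_def by (auto simp: inner_commute mult.commute)
    \<comment> \<open>For t = 0 the vector \<open>x\<close> is a recession direction violating
      \<open>bdd\<close>; for t < 0 the feasible point -x/t would have a value below the
      infimum.\<close>
    show ?thesis
    proof (cases "t = 0")
      case True
      then show ?thesis
        using bdd [of x] x neg by auto
    next
      case False
      with t have "t < 0" by simp
      have "\<beta> i \<le> a i \<bullet> ((- 1 / t) *\<^sub>R x)" for i
        using x [of i] \<open>t < 0\<close> by (simp add: field_simps)
      then have "p \<le> d \<bullet> ((- 1 / t) *\<^sub>R x)"
        by (intro p_le) auto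
      then show ?thesis
        using neg \<open>t < 0\<close> by (simp add: field_simps)
    qed
  qed
  \<comment> \<open>Attainment: the constraint \<open>d \<bullet> x \<le> p\<close> is added at
    index \<open>None\<close>. If the enlarged system were infeasible, dividing its certificate by
    the multiplier of this constraint would give a lower bound larger than \<open>p\<close>.\<close>
  define a' where "a' = case_option (- d) a"
  define \<beta>' where "\<beta>' = case_option (- p) \<beta>"
  obtain x where x: "\<And>j. \<beta>' j \<le> a' j \<bullet> x"
  proof (rule gale_alternative [of \<beta>' a'])
    fix v :: "'i option \<Rightarrow> real"
    assume v: "\<And>j. 0 \<le> v j" "(\<Sum>j\<in>UNIV. v j *\<^sub>R a' j) = 0" "(\<Sum>j\<in>UNIV. v j * \<beta>' j) = 1"
    let ?v = "\<lambda>i. v (Some i)"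
    have sum_a: "(\<Sum>i\<in>UNIV. ?v i *\<^sub>R a i) = v None *\<^sub>R d"
      using v(2) by (simp add: a'_def UNIV_option_conv sum.reindex)
    have sum_b: "(\<Sum>i\<in>UNIV. ?v i * \<beta> i) = 1 + v None * p"
      using v(3) by (simp add: \<beta>'_def UNIV_option_conv sum.reindex)
    have le: "1 + v None * p \<le> v None * (d \<bullet> x)" if "x \<in> ?X" for x
      using weak [of ?v x] v(1) that by (simp add: sum_a sum_b)
    show ?thesis
    proof (cases "v None = 0")
      case True
      with le [of x0] feas show ?thesis by auto
    next
      case False
      with v(1) [of None] have pos: "0 < v None" by simp
      have "1 / v None + p \<le> p"
        using le pos by (intro p_ge) (simp add: field_simps)
      with pos show ?thesis by (simp add: field_simps)
    qed
  qed (use that in auto)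
  have X: "\<And>i. \<beta> i \<le> a i \<bullet> x" and le: "d \<bullet> x \<le> p"
    using x [of "Some _"] x [of None] by (auto simp: a'_def \<beta>'_def)
  have "(\<Sum>i\<in>UNIV. u i * \<beta> i) \<le> d \<bullet> x"
    using weak [of u x] u X by auto
  with le u(3) have "d \<bullet> x = (\<Sum>i\<in>UNIV. u i * \<beta> i)"
    by simp
  with X u that show ?thesis by blast
qed

subsection \<open>Extreme points of polyhedra without lines\<close>

text \<open>A minimal generating subset \<open>W\<close> of \<open>V\<close> consists of extreme points.\<close>

lemma extreme_points_generate:
  fixes V K :: "'a::real_vector set"
  assumes "finite V" and K: "convex_cone K" and pointed: "\<And>k. k \<in> K \<Longrightarrow> - k \<in> K \<Longrightarrow> k = 0"
  obtains W where "W \<subseteq> V" "convex hull W + K = convex hull V + K"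
    "\<And>v. v \<in> W \<Longrightarrow> v extreme_point_of (convex hull V + K)"
proof -
  let ?gen = "\<lambda>W. W \<subseteq> V \<and> convex hull W + K = convex hull V + K"
  obtain W where W: "?gen W" and minimal: "\<And>W'. ?gen W' \<Longrightarrow> card W \<le> card W'"
    using ex_has_least_nat [of ?gen V card] by auto
  have "finite W"
    using W assms(1) finite_subset by blast
  have cK: "convex K" and K0: "0 \<in> K"
    using K by (auto simp: convex_cone_def convex_cone_contains_0)
  have "v extreme_point_of (convex hull W + K)" if "v \<in> W" for v
    unfolding extreme_point_of_def
  proof (intro conjI ballI notI)
    show "v \<in> convex hull W + K"
      using set_plus_intro [of v "convex hull W" 0 K] that K0 by (simp add: hull_inc)
  next
    fix a b assume "a \<in> convex hull W + K" "b \<in> convex hull W + K" and seg: "v \<in> open_segment a b"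
    then obtain wa ka wb kb where a: "a = wa + ka" and b: "b = wb + kb"
      and wab: "wa \<in> convex hull W" "wb \<in> convex hull W" and kab: "ka \<in> K" "kb \<in> K"
      by (elim set_plus_elim) auto
    obtain s where "a \<noteq> b" and s: "0 < s" "s < 1" and v: "v = (1 - s) *\<^sub>R a + s *\<^sub>R b"
      using seg by (auto simp: in_segment)
    define W' where "W' = W - {v}"
    have Wins: "W = insert v W'"
      using that by (auto simp: W'_def)
    \<comment> \<open>The share of \<open>v\<close> is split off. If \<open>W'\<close> is empty,
      \<alpha> = 1 and \<open>z\<close> is an arbitrary value, whence the guard on
      \<open>z\<close>.\<close>
    have decomp: "\<exists>\<alpha> z. 0 \<le> \<alpha> \<and> \<alpha> \<le> 1 \<and> w = \<alpha> *\<^sub>R v + (1 - \<alpha>) *\<^sub>R z \<and>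
        (\<alpha> < 1 \<longrightarrow> z \<in> convex hull W')" if "w \<in> convex hull W" for w
    proof (cases "W' = {}")
      case True
      with that show ?thesis by (auto simp: Wins intro!: exI [of _ 1])
    next
      case False
      with that obtain \<alpha> \<alpha>' z where "0 \<le> \<alpha>" "0 \<le> \<alpha>'" "\<alpha> + \<alpha>' = 1" "z \<in> convex hull W'"
        "w = \<alpha> *\<^sub>R v + \<alpha>' *\<^sub>R z"
        unfolding Wins convex_hull_insert [OF False] by auto
      moreover from this have "\<alpha>' = 1 - \<alpha>" by simp
      ultimately show ?thesis by (intro exI [of _ \<alpha>] exI [of _ z]) auto
    qed
    obtain \<alpha> za where \<alpha>: "0 \<le> \<alpha>" "\<alpha> \<le> 1" "wa = \<alpha> *\<^sub>R v + (1 - \<alpha>) *\<^sub>R za"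
      "\<alpha> < 1 \<Longrightarrow> za \<in> convex hull W'"
      using decomp [OF wab(1)] by auto
    obtain \<beta> zb where \<beta>: "0 \<le> \<beta>" "\<beta> \<le> 1" "wb = \<beta> *\<^sub>R v + (1 - \<beta>) *\<^sub>R zb"
      "\<beta> < 1 \<Longrightarrow> zb \<in> convex hull W'"
      using decomp [OF wab(2)] by auto
    \<comment> \<open>\<open>p\<close> and \<open>r\<close> are the weights that the representations
      of \<open>a\<close> and \<open>b\<close> leave on \<open>W'\<close> in the combination giving
      \<open>v\<close>.\<close>
    define p where "p = (1 - s) * (1 - \<alpha>)"
    define r where "r = s * (1 - \<beta>)"
    define k where "k = (1 - s) *\<^sub>R ka + s *\<^sub>R kb"
    have k: "k \<in> K"
      unfolding k_def using kab s by (intro convex_cone_add [OF K] convex_cone_scaleR [OF K]) auto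
    have pr: "0 \<le> p" "0 \<le> r" "p > 0 \<Longrightarrow> \<alpha> < 1" "r > 0 \<Longrightarrow> \<beta> < 1"
      using \<alpha> \<beta> s by (auto simp: p_def r_def zero_less_mult_iff)
    have eq: "(p + r) *\<^sub>R v = p *\<^sub>R za + r *\<^sub>R zb + k"
    proof -
      have "v = (1 - s) *\<^sub>R (\<alpha> *\<^sub>R v + (1 - \<alpha>) *\<^sub>R za + ka) + s *\<^sub>R (\<beta> *\<^sub>R v + (1 - \<beta>) *\<^sub>R zb + kb)"
        using v unfolding a b \<alpha>(3) \<beta>(3) .
      also have "\<dots> = (1 - p - r) *\<^sub>R v + (p *\<^sub>R za + r *\<^sub>R zb + k)"
        by (simp add: p_def r_def k_def algebra_simps)
      finally show ?thesis
        by (simp add: algebra_simps)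
    qed
    \<comment> \<open>If no weight is left on \<open>W'\<close>, pointedness kills both cone parts
      and a = b. Otherwise \<open>eq\<close> can be solved for \<open>v\<close>, so that
      \<open>W'\<close> already generates everything, against minimality.\<close>
    show False
    proof (cases "p + r = 0")
      case True
      with pr have p0: "p = 0" "r = 0" by auto
      with s have "\<alpha> = 1" "\<beta> = 1" by (auto simp: p_def r_def)
      have "(1 - s) *\<^sub>R ka + s *\<^sub>R kb = 0"
        using eq p0 by (simp add: k_def)
      then have "- ((1 - s) *\<^sub>R ka) = s *\<^sub>R kb"
        by (metis minus_unique)
      moreover have "(1 - s) *\<^sub>R ka \<in> K" "s *\<^sub>R kb \<in> K"
        using kab s by (auto intro: convex_cone_scaleR [OF K])
      ultimately have "(1 - s) *\<^sub>R ka = 0" "s *\<^sub>R kb = 0"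
        using pointed [of "(1 - s) *\<^sub>R ka"] by auto
      then have "ka = 0" "kb = 0"
        using s by auto
      then show False
        using \<open>a \<noteq> b\<close> a b \<alpha>(3) \<beta>(3) \<open>\<alpha> = 1\<close> \<open>\<beta> = 1\<close> by simp
    next
      case False
      with pr have pos: "0 < p + r" by simp
      define z where "z = (p / (p + r)) *\<^sub>R za + (r / (p + r)) *\<^sub>R zb"
      have sum1: "p / (p + r) + r / (p + r) = 1"
        using pos by (simp add: add_divide_distrib [symmetric])
      have z: "z \<in> convex hull W'"
      proof (cases "p = 0 \<or> r = 0")
        case True
        then show ?thesis
          using pos pr \<alpha>(4) \<beta>(4) by (auto simp: z_def)
      next
        case False
        then show ?thesis
          unfolding z_def using pos pr \<alpha>(4) \<beta>(4) sum1
          by (intro convexD [OF convex_convex_hull]) auto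
      qed
      have "v = (1 / (p + r)) *\<^sub>R ((p + r) *\<^sub>R v)"
        using pos by simp
      also have "\<dots> = z + (1 / (p + r)) *\<^sub>R k"
        unfolding eq by (simp add: z_def algebra_simps)
      finally have vin: "v \<in> convex hull W' + K"
        using set_plus_intro [OF z convex_cone_scaleR [OF K _ k, of "1 / (p + r)"]] pos by simp
      have conv': "convex (convex hull W' + K)"
        by (simp add: cK convex_set_plus)
      have "W' \<subseteq> convex hull W' + K"
      proof
        fix x assume "x \<in> W'"
        then show "x \<in> convex hull W' + K"
          using set_plus_intro [of x "convex hull W'" 0 K] K0 by (simp add: hull_inc)
      qed
      with vin conv' have sub: "convex hull W \<subseteq> convex hull W' + K"
        unfolding Wins by (intro hull_minimal) auto
      have "convex hull W + K \<subseteq> convex hull W' + K"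
      proof
        fix x assume "x \<in> convex hull W + K"
        then obtain y k1 where "x = y + k1" "y \<in> convex hull W" "k1 \<in> K"
          by (elim set_plus_elim) auto
        moreover from this sub obtain y' k2 where "y = y' + k2" "y' \<in> convex hull W'" "k2 \<in> K"
          by (meson set_plus_elim subsetD)
        ultimately show "x \<in> convex hull W' + K"
          using set_plus_intro [of y' "convex hull W'" "k2 + k1" K]
          by (simp add: convex_cone_add [OF K] add.assoc)
      qed
      moreover have "convex hull W' + K \<subseteq> convex hull W + K"
        by (intro set_plus_mono2 hull_mono) (auto simp: Wins)
      ultimately have "?gen W'"
        using W by (auto simp: W'_def)
      then have "card W \<le> card W'"
        by (rule minimal)
      then show False
        using card_Diff1_less [OF \<open>finite W\<close> that] by (simp add: W'_def)
    qed
  qed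
  with W that show ?thesis by metis
qed

subsection \<open>Scalarizations and the coupling function\<close>

lemma less_eq_vec_nth: "x \<le> y \<longleftrightarrow> (\<forall>i. x $ i \<le> y $ i)"
  for x y :: "real^'n"
  by (simp add: less_eq_vec_def)

lemma inner_transpose: "(transpose A *v u) \<bullet> x = u \<bullet> (A *v x)"
  for A :: "real^'n^'m"
  by (simp add: dot_lmul_matrix)

lemma transpose_matrix_vector_sum: "transpose B *v u = (\<Sum>i\<in>UNIV. u $ i *\<^sub>R row i B)"
  for B :: "real^'n^'m"
  by (simp add: vec_eq_iff vector_matrix_mult_def row_def mult.commute)

lemma matrix_vector_nth: "(B *v x) $ i = row i B \<bullet> x"
  for B :: "real^'n^'m"
  by (simp add: matrix_vector_mult_def row_def inner_vec_def)

lemma feasible_iff: "x \<in> feasible B b \<longleftrightarrow> (\<forall>i. b $ i \<le> row i B \<bullet> x)"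
  by (simp add: feasible_def less_eq_vec_nth matrix_vector_nth)

lemma feasible_add: "x \<in> feasible B b \<Longrightarrow> k \<in> feasible B 0 \<Longrightarrow> x + k \<in> feasible B b"
  by (simp add: feasible_iff inner_add_right) (metis add.right_neutral add_mono)

lemma polyhedron_feasible: "polyhedron (feasible B b)"
proof -
  have "feasible B b = \<Inter> (range (\<lambda>i. {x. row i B \<bullet> x \<ge> b $ i}))"
    by (auto simp: feasible_iff)
  also have "polyhedron \<dots>"
    by (intro polyhedron_Inter) (auto simp: polyhedron_halfspace_ge)
  finally show ?thesis .
qed

section \<open>Duality for the scalarized programs\<close>

lemma weak_duality:
  assumes "x \<in> feasible B b" "transpose B *v u = transpose P *v w" "0 \<le> u"
  shows "b \<bullet> u \<le> w \<bullet> (P *v x)"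
proof -
  have "b \<bullet> u \<le> (B *v x) \<bullet> u"
    using assms by (auto simp: inner_vec_def feasible_def less_eq_vec_nth intro!: sum_mono mult_right_mono)
  also have "\<dots> = w \<bullet> (P *v x)"
    using assms(2) inner_transpose [of B u x] inner_transpose [of P w x] by (simp add: inner_commute)
  finally show ?thesis .
qed

lemma opt_P1_D1_exist:
  fixes B :: "real^'n^'m" and P :: "real^'n^'q"
  assumes "feasible B b \<noteq> {}" and bdd: "\<And>k. k \<in> feasible B 0 \<Longrightarrow> 0 \<le> w \<bullet> (P *v k)"
  obtains x u where "opt_P1 B b P w x" "opt_D1 B b P w u" "w \<bullet> (P *v x) = b \<bullet> u"
proof -
  obtain x0 where x0: "x0 \<in> feasible B b"
    using assms(1) by auto
  obtain x u where x: "\<And>i. b $ i \<le> row i B \<bullet> x" and u: "\<And>i. 0 \<le> u i"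
    and eq: "(\<Sum>i\<in>UNIV. u i *\<^sub>R row i B) = transpose P *v w"
    and val: "(transpose P *v w) \<bullet> x = (\<Sum>i\<in>UNIV. u i * b $ i)"
  proof (rule lp_strong_duality [of "\<lambda>i. b $ i" "\<lambda>i. row i B" x0 "transpose P *v w"])
    show "b $ i \<le> row i B \<bullet> x0" for i
      using x0 by (simp add: feasible_iff)
    show "0 \<le> (transpose P *v w) \<bullet> k" if "\<And>i. 0 \<le> row i B \<bullet> k" for k
      unfolding inner_transpose by (intro bdd) (simp add: that feasible_iff)
  qed (use that in auto)
  let ?u = "\<chi> i. u i"
  have xf: "x \<in> feasible B b"
    using x by (simp add: feasible_iff)
  have ueq: "transpose B *v ?u = transpose P *v w"
    unfolding transpose_matrix_vector_sum [of B] using eq by simp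
  have u0: "0 \<le> ?u"
    using u by (simp add: less_eq_vec_nth)
  have val': "w \<bullet> (P *v x) = b \<bullet> ?u"
    using val unfolding inner_transpose by (simp add: inner_vec_def mult.commute)
  show ?thesis
  proof
    show "opt_P1 B b P w x"
      unfolding opt_P1_def val' using xf weak_duality [OF _ ueq u0] by auto
    show "opt_D1 B b P w ?u"
      unfolding opt_D1_def val' [symmetric] using ueq u0 weak_duality [OF xf] by blast
  qed (rule val')
qed

text \<open>Dual feasibility of \<open>u\<close> bounds the primal program along recession
  directions, so strong duality provides one pair with equal values. Arbitrary optimal solutions, as
  returned by \<open>solve\<close>, share these values.\<close>

lemma opt_P1_D1_values_eq:
  assumes x: "opt_P1 B b P w x" and u: "opt_D1 B b P w u"
  shows "w \<bullet> (P *v x) = b \<bullet> u"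
proof -
  have ne: "feasible B b \<noteq> {}"
    using x by (auto simp: opt_P1_def)
  have "0 \<le> w \<bullet> (P *v k)" if "k \<in> feasible B 0" for k
    using weak_duality [OF that, of u P w] u by (auto simp: opt_D1_def)
  then obtain x' u' where *: "opt_P1 B b P w x'" "opt_D1 B b P w u'" "w \<bullet> (P *v x') = b \<bullet> u'"
    using opt_P1_D1_exist [OF ne] by blast
  then have "w \<bullet> (P *v x) = w \<bullet> (P *v x')" "b \<bullet> u = b \<bullet> u'"
    using x u by (auto simp: opt_P1_def opt_D1_def intro!: antisym)
  with * show ?thesis by simp
qed

section \<open>The affine map w(t) and its invariance under vertical shifts\<close>

lemma wvec_eq: "c $ l = 1 \<Longrightarrow> wvec l c t = t + (1 - c \<bullet> t) *\<^sub>R axis l 1"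
  by (auto simp: vec_eq_iff wvec_def axis_def inner_vec_def sum.remove [of UNIV l])

lemma inner_wvec: "c $ l = 1 \<Longrightarrow> c \<bullet> wvec l c t = 1"
  by (simp add: wvec_eq inner_add_right inner_axis)

lemma wvec_add_axis: "c $ l = 1 \<Longrightarrow> wvec l c (t + r *\<^sub>R axis l 1) = wvec l c t"
  by (simp add: wvec_eq inner_add_right inner_axis algebra_simps)

lemma dual_obj_eq: "dual_obj l b (u, w) = w + (b \<bullet> u - w $ l) *\<^sub>R axis l 1"
  by (auto simp: vec_eq_iff dual_obj_def axis_def)

lemma dual_obj_nth_last: "dual_obj l b (u, w) $ l = b \<bullet> u"
  by (simp add: dual_obj_def)

lemma wvec_dual_obj: "c $ l = 1 \<Longrightarrow> c \<bullet> w = 1 \<Longrightarrow> wvec l c (dual_obj l b (u, w)) = w"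
  unfolding dual_obj_eq by (simp add: wvec_add_axis) (simp add: wvec_eq)

lemma dual_obj_wvec:
  "c $ l = 1 \<Longrightarrow> dual_obj l b (u, wvec l c t) = t + (b \<bullet> u - t $ l) *\<^sub>R axis l 1"
  by (auto simp: vec_eq_iff dual_obj_def axis_def wvec_def)

lemma convex_cone_hull_neg_axis: "convex_cone hull {- axis l 1} = uminus ` dual_cone_K l"
  by (subst convex_cone_hull_separate_nonempty) (auto simp: conic_hull_explicit dual_cone_K_def image_iff)

lemma minkowski_diff_eq: "minkowski_diff A K = A + uminus ` K"
  unfolding minkowski_diff_def set_plus_def by force

lemma minkowski_diff_K:
  "minkowski_diff A (dual_cone_K l) = A + convex_cone hull {- axis l 1}"
  by (simp add: minkowski_diff_eq convex_cone_hull_neg_axis)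

lemma mem_plus_neg_axis:
  "t \<in> A + convex_cone hull {- axis l 1} \<longleftrightarrow> (\<exists>r\<ge>0. t + r *\<^sub>R axis l 1 \<in> A)"
  for t :: "real^'q"
proof
  assume "t \<in> A + convex_cone hull {- axis l 1}"
  then obtain a r where "a \<in> A" "0 \<le> r" "t = a + - (r *\<^sub>R axis l 1)"
    by (auto simp: set_plus_def convex_cone_hull_neg_axis dual_cone_K_def)
  then show "\<exists>r\<ge>0. t + r *\<^sub>R axis l 1 \<in> A"
    by (intro exI [of _ r]) simp
next
  assume "\<exists>r\<ge>0. t + r *\<^sub>R axis l 1 \<in> A"
  then obtain r where r: "0 \<le> r" "t + r *\<^sub>R axis l 1 \<in> A" by auto
  have "t + r *\<^sub>R axis l 1 + - (r *\<^sub>R axis l 1) \<in> A + convex_cone hull {- axis l 1}"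
    using r by (intro set_plus_intro) (auto simp: convex_cone_hull_neg_axis dual_cone_K_def)
  then show "t \<in> A + convex_cone hull {- axis l 1}" by simp
qed

lemma cone_nonneg_iff:
  "(\<forall>d \<in> convex_cone hull D. 0 \<le> w \<bullet> d) \<longleftrightarrow> (\<forall>d\<in>D. 0 \<le> w \<bullet> d)"
proof
  assume "\<forall>d\<in>D. 0 \<le> w \<bullet> d"
  then have "convex_cone hull D \<subseteq> {d. 0 \<le> w \<bullet> d}"
    by (intro hull_minimal) (auto simp: convex_cone_halfspace_ge)
  then show "\<forall>d \<in> convex_cone hull D. 0 \<le> w \<bullet> d" by auto
qed (auto intro: hull_inc)

lemma hull_plus_cone_halfspace_iff:
  assumes "convex_cone K" "V \<noteq> {}"
  shows "(\<forall>y \<in> convex hull V + K. r \<le> w \<bullet> y) \<longleftrightarrow> (\<forall>v\<in>V. r \<le> w \<bullet> v) \<and> (\<forall>k\<in>K. 0 \<le> w \<bullet> k)"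
    (is "?L \<longleftrightarrow> ?R")
proof
  assume L: ?L
  obtain v0 where v0: "v0 \<in> V" using assms(2) by auto
  have K0: "0 \<in> K" by (rule convex_cone_contains_0 [OF assms(1)])
  have plus: "r \<le> w \<bullet> (v + k)" if "v \<in> V" "k \<in> K" for v k
    using L that by (auto intro!: set_plus_intro hull_inc)
  have "0 \<le> w \<bullet> k" if "k \<in> K" for k
  proof (rule ccontr)
    assume "\<not> 0 \<le> w \<bullet> k"
    then have neg: "w \<bullet> k < 0" by simp
    \<comment> \<open>So far along \<open>k\<close> the value has dropped from
      \<open>w \<bullet> v0\<close> to at most r - 1.\<close>
    define s where "s = (\<bar>r - w \<bullet> v0\<bar> + 1) / - (w \<bullet> k)"
    have "0 \<le> s" using neg by (simp add: s_def divide_nonneg_neg)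
    then have "r \<le> w \<bullet> (v0 + s *\<^sub>R k)"
      by (intro plus v0 convex_cone_scaleR [OF assms(1)] that)
    moreover have "s * (w \<bullet> k) = - (\<bar>r - w \<bullet> v0\<bar> + 1)"
      using neg by (simp add: s_def)
    ultimately show False by (simp add: inner_add_right)
  qed
  then show ?R
    using plus [OF _ K0] by simp
next
  assume R: ?R
  then have "convex hull V \<subseteq> {y. r \<le> w \<bullet> y}"
    using convex_halfspace_ge [of r w] by (intro hull_minimal) (auto simp: inner_commute)
  with R show ?L
    by (fastforce simp: set_plus_def inner_add_right)
qed

section \<open>Dual polyhedra of V-represented sets\<close>

lemma dual_polyhedron_vrep_iff:
  assumes "V \<noteq> {}"
  shows "t \<in> dual_polyhedron l c (convex hull V + convex_cone hull D) \<longleftrightarrow>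
    (\<forall>v\<in>V. t $ l \<le> wvec l c t \<bullet> v) \<and> (\<forall>d\<in>convex_cone hull D. 0 \<le> wvec l c t \<bullet> d)"
  using hull_plus_cone_halfspace_iff [OF convex_cone_convex_cone_hull assms,
    where r = "t $ l" and w = "wvec l c t"]
  by (simp add: dual_polyhedron_def coupling_def)

text \<open>A ball around \<open>c\<close> lies in \<open>C\<close>; testing \<open>w\<close> at its
  point farthest in direction -w gives the estimate. Consequently the slice
  \<open>c \<bullet> w = 1\<close> of the dual cone is bounded.\<close>

lemma interior_cone_inner_bound:
  fixes C :: "'a::euclidean_space set"
  assumes "c \<in> interior C"
  shows "\<exists>\<epsilon>>0. \<forall>w. (\<forall>y\<in>C. 0 \<le> w \<bullet> y) \<longrightarrow> \<epsilon> * norm w \<le> c \<bullet> w"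
proof -
  obtain e where e: "0 < e" "cball c e \<subseteq> C"
    using assms by (auto simp: mem_interior_cball)
  have "e * norm w \<le> c \<bullet> w" if w: "\<forall>y\<in>C. 0 \<le> w \<bullet> y" for w
  proof (cases "w = 0")
    case False
    have "c - (e / norm w) *\<^sub>R w \<in> C"
      using e False by (intro subsetD [OF e(2)]) (simp add: dist_norm)
    from bspec [OF w this] False show ?thesis
      by (simp add: inner_diff_right inner_commute dot_square_norm power2_eq_square)
  qed simp
  with e(1) show ?thesis by blast
qed

text \<open>The slice above a sufficiently low level is a polytope, and every point of the dual polyhedron
  can be lifted vertically into it.\<close>

lemma dual_polyhedron_vrep:
  fixes V D C :: "(real^'q) set"
  assumes V: "finite V" "V \<noteq> {}" and D: "finite D" and c: "c $ l = 1" "c \<in> interior C"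
    and C: "C \<subseteq> convex_cone hull D"
  obtains W where "is_vrep (dual_polyhedron l c (convex hull V + convex_cone hull D)) W {- axis l 1}"
proof -
  let ?T = "dual_polyhedron l c (convex hull V + convex_cone hull D)"
  have T: "?T = {t. (\<forall>v\<in>V. t $ l \<le> wvec l c t \<bullet> v) \<and> (\<forall>d\<in>D. 0 \<le> wvec l c t \<bullet> d)}"
    using dual_polyhedron_vrep_iff [OF V(2), of _ l c D] by (auto simp: cone_nonneg_iff)
  obtain \<epsilon> where \<epsilon>: "0 < \<epsilon>" "\<And>w. \<forall>y\<in>C. 0 \<le> w \<bullet> y \<Longrightarrow> \<epsilon> * norm w \<le> c \<bullet> w"
    using interior_cone_inner_bound [OF c(2)] by blast
  have norm_w: "norm (wvec l c t) \<le> 1 / \<epsilon>" if "t \<in> ?T" for t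
  proof -
    have "\<epsilon> * norm (wvec l c t) \<le> 1"
      using \<epsilon>(2) [of "wvec l c t"] that C
      unfolding dual_polyhedron_vrep_iff [OF V(2)] inner_wvec [OF c(1)] by blast
    with \<epsilon>(1) show ?thesis by (simp add: field_simps)
  qed
  \<comment> \<open>\<open>M\<close> bounds all values \<open>wvec l c t \<bullet> v\<close> on the
    dual polyhedron, so raising \<open>t $ l\<close> to -M never violates a constraint coming from
    \<open>V\<close>.\<close>
  define M where "M = (\<Sum>v\<in>V. norm v) / \<epsilon>"
  have bound: "\<bar>wvec l c t \<bullet> v\<bar> \<le> M" if "t \<in> ?T" "v \<in> V" for t v
  proof -
    have "\<bar>wvec l c t \<bullet> v\<bar> \<le> norm (wvec l c t) * norm v"
      by (rule Cauchy_Schwarz_ineq2)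
    also have "\<dots> \<le> (1 / \<epsilon>) * (\<Sum>v\<in>V. norm v)"
      using norm_w [OF that(1)] V(1) that(2) \<epsilon>(1) by (intro mult_mono member_le_sum) auto
    finally show ?thesis by (simp add: M_def)
  qed
  define Q where "Q = ?T \<inter> {t. - M \<le> t $ l}"
  have "polyhedron Q"
  proof -
    have w: "wvec l c t \<bullet> d = d $ l - (d $ l *\<^sub>R c - d) \<bullet> t" for t d
      by (simp add: wvec_eq [of c, OF c(1)] inner_add_left inner_diff_left inner_axis' inner_commute [of t d] algebra_simps)
    have "{t. t $ l \<le> wvec l c t \<bullet> v} = {t. (axis l 1 + v $ l *\<^sub>R c - v) \<bullet> t \<le> v $ l}" for v
      by (auto simp: w inner_add_left inner_diff_left inner_axis')
    then have 1: "polyhedron {t. t $ l \<le> wvec l c t \<bullet> v}" for v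
      by (simp add: polyhedron_halfspace_le)
    have "{t. 0 \<le> wvec l c t \<bullet> d} = {t. (d $ l *\<^sub>R c - d) \<bullet> t \<le> d $ l}" for d
      by (auto simp: w)
    then have 2: "polyhedron {t. 0 \<le> wvec l c t \<bullet> d}" for d
      by (simp add: polyhedron_halfspace_le)
    have "{t. - M \<le> t $ l} = {t. axis l 1 \<bullet> t \<ge> - M}"
      by (simp add: inner_axis')
    then have 3: "polyhedron {t::real^'q. - M \<le> t $ l}"
      by (simp add: polyhedron_halfspace_ge)
    have "?T = \<Inter> ((\<lambda>v. {t. t $ l \<le> wvec l c t \<bullet> v}) ` V) \<inter> \<Inter> ((\<lambda>d. {t. 0 \<le> wvec l c t \<bullet> d}) ` D)"
      unfolding T by auto
    also have "polyhedron \<dots>"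
      using V(1) D 1 2 by (intro polyhedron_Int polyhedron_Inter) auto
    finally show ?thesis
      unfolding Q_def using 3 by (rule polyhedron_Int)
  qed
  moreover have "bounded Q"
    unfolding bounded_iff
  proof (intro exI ballI)
    fix t assume "t \<in> Q"
    then have t: "t \<in> ?T" "- M \<le> t $ l" by (auto simp: Q_def)
    obtain v where v: "v \<in> V" using V(2) by auto
    have "t $ l \<le> M"
      using t(1) bound [OF t(1) v] v unfolding T by force
    with t(2) have tl: "\<bar>t $ l\<bar> \<le> M" by simp
    \<comment> \<open>\<open>t\<close> differs from w(t) only in the last coordinate, so bounds on
      w(t) and on \<open>t $ l\<close> bound \<open>t\<close>.\<close>
    have "t = wvec l c t + (t $ l - wvec l c t $ l) *\<^sub>R axis l 1"
      by (auto simp: vec_eq_iff wvec_def axis_def)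
    then have "norm t \<le> norm (wvec l c t) + norm ((t $ l - wvec l c t $ l) *\<^sub>R axis l 1 :: real^'q)"
      by (metis norm_triangle_ineq)
    also have "\<dots> \<le> norm (wvec l c t) + (M + norm (wvec l c t))"
      using tl component_le_norm_cart [of "wvec l c t" l] by (simp add: norm_axis_1)
    finally show "norm t \<le> 1 / \<epsilon> + (M + 1 / \<epsilon>)"
      using norm_w [OF t(1)] by simp
  qed
  ultimately have "polytope Q"
    by (simp add: polytope_eq_bounded_polyhedron)
  then obtain W where W: "finite W" "Q = convex hull W"
    by (auto simp: polytope_def)
  have "?T = Q + convex_cone hull {- axis l 1}"
  proof (intro set_eqI iffI)
    fix t assume t: "t \<in> ?T"
    \<comment> \<open>The least lift that reaches level -M; it leaves w(t) unchanged.\<close>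
    define r where "r = max 0 (- M - t $ l)"
    have "t + r *\<^sub>R axis l 1 \<in> Q"
      using t bound [OF t] unfolding Q_def T r_def
      by (auto simp: wvec_add_axis [OF c(1)] max_def) (smt (verit, best))+
    then show "t \<in> Q + convex_cone hull {- axis l 1}"
      unfolding mem_plus_neg_axis by (intro exI [of _ r]) (auto simp: r_def)
  next
    fix t assume "t \<in> Q + convex_cone hull {- axis l 1}"
    then obtain r where r: "0 \<le> r" "t + r *\<^sub>R axis l 1 \<in> ?T"
      by (auto simp: mem_plus_neg_axis Q_def)
    then show "t \<in> ?T"
      unfolding T by (force simp: wvec_add_axis [OF c(1)])
  qed
  then have "is_vrep ?T W {- axis l 1}"
    using W by (simp add: is_vrep_def)
  then show ?thesis by (rule that)
qed

section \<open>Auxiliary facts on sums, slopes and convexity\<close>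

lemma convex_cone_hull_Un_set_plus:
  "convex_cone hull (S \<union> T) = convex_cone hull S + convex_cone hull T"
  by (auto simp: convex_cone_hull_Un set_plus_def)

lemma closed_set_plus_compact:
  fixes A :: "'a::real_normed_vector set"
  assumes "compact A" "closed K"
  shows "closed (A + K)"
proof -
  have "A + K = (\<Union>x\<in>A. \<Union>y\<in>K. {x + y})"
    by (auto simp: set_plus_def)
  with compact_closed_sums [OF assms] show ?thesis by simp
qed

text \<open>For m < 0 the choice r = (|a| + 1) / (-m) gives a - |a| - 1 < 0. This turns rays inside
  a dual polyhedron into conditions on their direction.\<close>

lemma nonneg_slope:
  fixes a m :: real
  assumes "\<And>r. 0 \<le> r \<Longrightarrow> 0 \<le> a + r * m"
  shows "0 \<le> m"
proof (rule ccontr)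
  assume "\<not> 0 \<le> m"
  then have "m < 0" by simp
  then have "(\<bar>a\<bar> + 1) / (- m) * m = - (\<bar>a\<bar> + 1)" and "0 \<le> (\<bar>a\<bar> + 1) / (- m)"
    by (simp_all add: divide_nonneg_neg)
  with assms [of "(\<bar>a\<bar> + 1) / (- m)"] show False
    by linarith
qed

lemma nonneg_vec_combination:
  "0 \<le> x \<Longrightarrow> 0 \<le> y \<Longrightarrow> 0 \<le> p \<Longrightarrow> 0 \<le> r \<Longrightarrow> 0 \<le> p *\<^sub>R x + r *\<^sub>R y"
  for x y :: "real^'n"
  by (simp add: less_eq_vec_nth)

lemma convex_dual_feasible: "convex (dual_feasible B P Y c)"
  unfolding convex_def dual_feasible_def
  by (auto simp: nonneg_vec_combination matrix_vector_right_distrib matrix_vector_mult_scaleR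
      inner_add_right simp del: transpose_matrix_vector simp flip: distrib_right)

lemma linear_dual_obj: "linear (dual_obj l b)"
  by (rule linearI) (auto simp: dual_obj_def vec_eq_iff inner_add_right algebra_simps)

subsection \<open>Upper and lower image\<close>

locale vlp =
  fixes B :: "real^'n^'m" and b :: "real^'m" and P :: "real^'n^'q" and Y :: "real^'p^'q"
    and C :: "(real^'q) set" and c :: "real^'q" and l :: 'q
    and Sh :: "(real^'n) set" and Th :: "((real^'m) \<times> (real^'q)) set"
  assumes Y_gen: "C = convex_cone hull (columns Y)"
    and c_int: "c \<in> interior C" and c_last: "c $ l = 1"
    and S_nonempty: "feasible B b \<noteq> {}"
    and vertex: "\<exists>v. v extreme_point_of (upper_image B 0 P C)"
    and input_primal: "primal_solution B 0 P C {0} Sh"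
    and input_dual: "dual_solution l B 0 P Y c Th"
begin

abbreviation Td where "Td \<equiv> T_dirs P Y Sh"

abbreviation K where "K \<equiv> convex_cone hull Td"

section \<open>The cone \<open>K\<close> of known directions\<close>

lemma convex_cone_C: "convex_cone C"
  unfolding Y_gen by (rule convex_cone_convex_cone_hull)

lemma convex_C: "convex C"
  using convex_cone_C by (simp add: convex_cone_def)

lemma convex_cone_K: "convex_cone K"
  by (rule convex_cone_convex_cone_hull)

lemma finite_Td: "finite Td"
proof -
  have "columns Y = range (\<lambda>i. column i Y)"
    by (auto simp: columns_def)
  then show ?thesis
    using input_primal by (simp add: T_dirs_def primal_solution_def finite_infimizer_def)
qed

text \<open>The point part of the input solution is {0}, so the infimizer equation contains only
  cones. The vertex assumption thereby becomes a statement about \<open>K\<close>.\<close>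

lemma upper_image_homogeneous: "upper_image B 0 P C = K"
proof -
  have "upper_image B 0 P C = convex hull ((\<lambda>x. P *v x) ` {0}) + convex_cone hull ((\<lambda>x. P *v x) ` Sh) + C"
    using input_primal by (simp add: primal_solution_def finite_infimizer_def)
  then show ?thesis
    by (simp add: T_dirs_def convex_cone_hull_Un_set_plus Y_gen)
qed

lemma C_subset_K: "C \<subseteq> K"
  unfolding Y_gen T_dirs_def by (intro hull_mono) auto

lemma K_cases:
  assumes "k \<in> K"
  obtains x z where "k = P *v x + z" "x \<in> feasible B 0" "z \<in> C"
  using assms unfolding upper_image_homogeneous [symmetric] upper_image_def
  by (elim set_plus_elim) auto

lemma image_homogeneous_in_K: "x \<in> feasible B 0 \<Longrightarrow> P *v x \<in> K"
  unfolding upper_image_homogeneous [symmetric] upper_image_def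
  using set_plus_intro [of "P *v x" _ 0 C] convex_cone_contains_0 [OF convex_cone_C] by auto

text \<open>A vertex \<open>v\<close> of \<open>K\<close> would be the midpoint of v + k and v -
  k.\<close>

lemma K_pointed:
  assumes "k \<in> K" "- k \<in> K"
  shows "k = 0"
proof (rule ccontr)
  assume "k \<noteq> 0"
  obtain v where v: "v extreme_point_of K"
    using vertex unfolding upper_image_homogeneous by auto
  then have "v \<in> K" by (simp add: extreme_point_of_def)
  with assms have "v + k \<in> K" "v + - k \<in> K"
    by (blast intro: convex_cone_hull_add)+
  moreover have "v \<in> open_segment (v + k) (v + - k)"
    unfolding in_segment
  proof (intro conjI exI [of _ "1/2"])
    show "v + k \<noteq> v + - k"
      using \<open>k \<noteq> 0\<close> by (metis add_left_cancel real_vector.scale_eq_0_iff scaleR_2 add_eq_0_iff zero_neq_numeral)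
    show "v = (1 - 1 / 2) *\<^sub>R (v + k) + (1 / 2) *\<^sub>R (v + - k)"
      by (simp add: algebra_simps flip: scaleR_add_left)
  qed auto
  ultimately show False
    using v by (auto simp: extreme_point_of_def)
qed

lemma inner_c_pos: "\<exists>\<epsilon>>0. \<forall>w. (\<forall>k\<in>K. 0 \<le> w \<bullet> k) \<longrightarrow> \<epsilon> * norm w \<le> c \<bullet> w"
  using interior_cone_inner_bound [OF c_int] C_subset_K by (meson subsetD)

lemma convex_upper_image: "convex (upper_image B b P C)"
  unfolding upper_image_def
  by (intro convex_set_plus convex_linear_image convex_C polyhedron_imp_convex polyhedron_feasible)
    (simp add: linear_linear)

lemma image_in_upper_image: "x \<in> feasible B b \<Longrightarrow> P *v x \<in> upper_image B b P C"
  unfolding upper_image_def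
  using set_plus_intro [of "P *v x" _ 0 C] convex_cone_contains_0 [OF convex_cone_C] by auto

lemma upper_image_add_K:
  assumes "y \<in> upper_image B b P C" "k \<in> K"
  shows "y + k \<in> upper_image B b P C"
proof -
  obtain x z where y: "y = P *v x + z" "x \<in> feasible B b" "z \<in> C"
    using assms(1) unfolding upper_image_def by (elim set_plus_elim) auto
  obtain x' z' where k: "k = P *v x' + z'" "x' \<in> feasible B 0" "z' \<in> C"
    using assms(2) by (rule K_cases)
  have "P *v (x + x') + (z + z') \<in> upper_image B b P C"
    unfolding upper_image_def using y k
    by (intro set_plus_intro imageI feasible_add convex_cone_add [OF convex_cone_C])
  then show ?thesis
    by (simp add: y k matrix_vector_right_distrib algebra_simps)
qed

text \<open>The constraint on \<open>Y\<close> only gives nonnegativity on \<open>C\<close>; on the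
  images of homogeneous feasible points it follows from the equation for \<open>u\<close> by weak
  duality with right-hand side 0. Stated with \<open>K\<close>, the condition matches the one
  describing dual polyhedra.\<close>

lemma dual_feasible_iff:
  "(u, w) \<in> dual_feasible B P Y c \<longleftrightarrow>
    0 \<le> u \<and> transpose B *v u = transpose P *v w \<and> c \<bullet> w = 1 \<and> (\<forall>k\<in>K. 0 \<le> w \<bullet> k)"
proof -
  have "0 \<le> transpose Y *v w \<longleftrightarrow> (\<forall>i. 0 \<le> w \<bullet> column i Y)"
    by (simp add: less_eq_vec_nth vector_matrix_mult_def column_def inner_vec_def mult.commute)
  also have "\<dots> \<longleftrightarrow> (\<forall>z\<in>C. 0 \<le> w \<bullet> z)"
    unfolding Y_gen cone_nonneg_iff by (auto simp: columns_def)
  finally have Y_iff: "0 \<le> transpose Y *v w \<longleftrightarrow> (\<forall>z\<in>C. 0 \<le> w \<bullet> z)" .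
  have "\<forall>k\<in>K. 0 \<le> w \<bullet> k"
    if "0 \<le> u" "transpose B *v u = transpose P *v w" "\<forall>z\<in>C. 0 \<le> w \<bullet> z"
  proof
    fix k assume "k \<in> K"
    then obtain x z where k: "k = P *v x + z" "x \<in> feasible B 0" "z \<in> C"
      by (rule K_cases)
    then show "0 \<le> w \<bullet> k"
      using that(3) weak_duality [OF k(2) that(2,1)] by (simp add: inner_add_right)
  qed
  then show ?thesis
    using C_subset_K unfolding dual_feasible_def by (auto simp: Y_iff simp del: transpose_matrix_vector)
qed

lemma dual_le_primal:
  assumes "(u, w) \<in> dual_feasible B P Y c" "y \<in> upper_image B b P C"
  shows "b \<bullet> u \<le> w \<bullet> y"
proof -
  obtain x z where y: "y = P *v x + z" "x \<in> feasible B b" "z \<in> C"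
    using assms(2) unfolding upper_image_def by (elim set_plus_elim) auto
  have u: "0 \<le> u" "transpose B *v u = transpose P *v w" and "0 \<le> w \<bullet> z"
    using assms(1) y(3) C_subset_K unfolding dual_feasible_iff by blast+
  then show ?thesis
    using weak_duality [OF y(2) u(2,1)] by (simp add: y inner_add_right)
qed

lemma solve_exists:
  assumes "\<forall>k\<in>K. 0 \<le> w \<bullet> k"
  obtains x u where "opt_P1 B b P w x" "opt_D1 B b P w u"
  using opt_P1_D1_exist [OF S_nonempty] assms image_homogeneous_in_K by metis

text \<open>The \<open>w\<close>-components of \<open>Th\<close> are nonnegative on
  \<open>K\<close>, a property that survives taking the mean and that bounds the linear
  program.\<close>

lemma solve_mean_exists: "\<exists>x. opt_P1 B b P (mean_w Th) x"
proof -
  have "\<forall>k\<in>K. 0 \<le> w \<bullet> k" if "w \<in> snd ` Th" for w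
  proof -
    from that obtain u where "(u, w) \<in> Th" by auto
    moreover have "Th \<subseteq> dual_feasible B P Y c"
      using input_dual by (simp add: dual_solution_def finite_supremizer_def)
    ultimately have "(u, w) \<in> dual_feasible B P Y c" by blast
    then show ?thesis by (simp add: dual_feasible_iff)
  qed
  then have "\<forall>k\<in>K. 0 \<le> mean_w Th \<bullet> k"
    unfolding mean_w_def by (intro ballI) (simp add: inner_sum_left sum_nonneg)
  then show ?thesis
    using solve_exists by metis
qed

section \<open>Results of the routine \<open>dual\<close>\<close>

lemma dual_result_exists:
  assumes "finite V" "V \<noteq> {}"
  shows "\<exists>W. dual_result l c V Td W \<and> finite W"
  using dual_polyhedron_vrep [OF assms finite_Td c_last c_int C_subset_K]
  unfolding dual_result_def by (metis is_vrep_def)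

lemma dual_polyhedron_iff:
  assumes "V \<noteq> {}"
  shows "t \<in> dual_polyhedron l c (convex hull V + K) \<longleftrightarrow>
    (\<forall>v\<in>V. t $ l \<le> wvec l c t \<bullet> v) \<and> (\<forall>k\<in>K. 0 \<le> wvec l c t \<bullet> k)"
  using assms by (rule dual_polyhedron_vrep_iff)

lemma dual_result_subset:
  assumes "dual_result l c V Td W"
  shows "W \<subseteq> dual_polyhedron l c (convex hull V + K)"
proof -
  obtain D where D: "dual_polyhedron l c (convex hull V + K) = convex hull W + convex_cone hull D"
    using assms by (auto simp: dual_result_def is_vrep_def)
  have "t \<in> convex hull W + convex_cone hull D" if "t \<in> W" for t
    using set_plus_intro [OF hull_inc [OF that, of convex] convex_cone_hull_contains_0 [of D]] by simp
  then show ?thesis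
    unfolding D by blast
qed

lemma dual_polyhedron_downward:
  assumes "V \<noteq> {}"
  shows "dual_polyhedron l c (convex hull V + K) + convex_cone hull {- axis l 1}
    \<subseteq> dual_polyhedron l c (convex hull V + K)"
proof
  fix t assume "t \<in> dual_polyhedron l c (convex hull V + K) + convex_cone hull {- axis l 1}"
  then obtain r where r: "0 \<le> r" "t + r *\<^sub>R axis l 1 \<in> dual_polyhedron l c (convex hull V + K)"
    by (auto simp: mem_plus_neg_axis)
  then have "t $ l + r \<le> wvec l c t \<bullet> v" if "v \<in> V" for v
    using that by (simp add: dual_polyhedron_iff [OF assms] wvec_add_axis [OF c_last])
  then have "t $ l \<le> wvec l c t \<bullet> v" if "v \<in> V" for v
    using r(1) that by force
  then show "t \<in> dual_polyhedron l c (convex hull V + K)"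
    using r by (simp add: dual_polyhedron_iff [OF assms] wvec_add_axis [OF c_last])
qed

text \<open>A recession direction \<open>d\<close> of the dual polyhedron changes \<open>w(t)\<close> by \<open>h = d - (c \<bullet> d) e\<^sup>q\<close>, which
  lies in the dual cone of \<open>C\<close> and satisfies \<open>c \<bullet> h = 0\<close>; hence \<open>h = 0\<close>.\<close>

lemma dual_result_vrep:
  assumes V: "V \<noteq> {}" and W: "dual_result l c V Td W"
  shows "is_vrep (dual_polyhedron l c (convex hull V + K)) W {- axis l 1}"
proof -
  let ?T = "dual_polyhedron l c (convex hull V + K)"
  obtain D where D: "?T = convex hull W + convex_cone hull D" and "finite W"
    using W by (auto simp: dual_result_def is_vrep_def)
  obtain \<epsilon> where \<epsilon>: "\<epsilon> > 0" "\<And>w. (\<forall>k\<in>K. 0 \<le> w \<bullet> k) \<Longrightarrow> \<epsilon> * norm w \<le> c \<bullet> w"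
    using inner_c_pos by auto
  have sub: "?T \<subseteq> convex hull W + convex_cone hull {- axis l 1}"
  proof
    fix t assume "t \<in> ?T"
    then obtain s d where t: "t = s + d" and s: "s \<in> convex hull W" and d: "d \<in> convex_cone hull D"
      unfolding D by (elim set_plus_elim) auto
    define h where "h = d - (c \<bullet> d) *\<^sub>R axis l 1"
    have ray: "s + r *\<^sub>R d \<in> ?T" if "0 \<le> r" for r
      unfolding D using s d that by (intro set_plus_intro convex_cone_hull_mul)
    have wv: "wvec l c (s + r *\<^sub>R d) = wvec l c s + r *\<^sub>R h" for r
      by (simp add: wvec_eq [of c, OF c_last] h_def inner_add_right algebra_simps)
    have "0 \<le> h \<bullet> k" if "k \<in> K" for k
    proof (rule nonneg_slope)
      fix r :: real assume "0 \<le> r"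
      then have "0 \<le> wvec l c (s + r *\<^sub>R d) \<bullet> k"
        using ray that dual_polyhedron_iff [OF V] by blast
      then show "0 \<le> wvec l c s \<bullet> k + r * (h \<bullet> k)"
        by (simp add: wv inner_add_left)
    qed
    moreover have "c \<bullet> h = 0"
      by (simp add: h_def inner_diff_right inner_axis c_last)
    ultimately have "\<epsilon> * norm h \<le> 0"
      using \<epsilon>(2) [of h] by simp
    with \<epsilon>(1) have h0: "h = 0"
      by (simp add: mult_le_0_iff)
    then have "d = (c \<bullet> d) *\<^sub>R axis l 1"
      by (simp add: h_def)
    then have dl: "d = d $ l *\<^sub>R axis l 1"
      by (metis axis_nth real_scaleR_def vector_scaleR_component mult.right_neutral)
    obtain v where v: "v \<in> V" using V by auto
    \<comment> \<open>With h = 0, w is constant along the ray, so the constraint of a single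
      \<open>v\<close> caps the last coordinate, which therefore cannot increase.\<close>
    have "0 \<le> - (d $ l)"
    proof (rule nonneg_slope [of "wvec l c s \<bullet> v - s $ l"])
      fix r :: real assume "0 \<le> r"
      then have "(s + r *\<^sub>R d) $ l \<le> wvec l c (s + r *\<^sub>R d) \<bullet> v"
        using ray v dual_polyhedron_iff [OF V] by blast
      then show "0 \<le> wvec l c s \<bullet> v - s $ l + r * - (d $ l)"
        by (simp add: wv h0)
    qed
    moreover have "t + (- (d $ l)) *\<^sub>R axis l 1 = s"
      using t dl by (metis add_diff_cancel_right' scaleR_minus_left uminus_add_conv_diff add.commute)
    ultimately show "t \<in> convex hull W + convex_cone hull {- axis l 1}"
      unfolding mem_plus_neg_axis using s by metis
  qed
  have "convex ?T"
    unfolding D by (intro convex_set_plus convex_convex_hull convex_convex_cone_hull)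
  then have "convex hull W \<subseteq> ?T"
    using dual_result_subset [OF W] by (simp add: hull_minimal)
  then have "convex hull W + convex_cone hull {- axis l 1} \<subseteq> ?T"
    using dual_polyhedron_downward [OF V] by (meson order_refl order_trans set_plus_mono2)
  with sub \<open>finite W\<close> show ?thesis
    by (simp add: is_vrep_def)
qed

section \<open>The lower image and its relation to the upper image\<close>

lemma lower_image_eq:
  "lower_image l B b P Y c = dual_obj l b ` dual_feasible B P Y c + convex_cone hull {- axis l 1}"
  unfolding lower_image_def by (rule minkowski_diff_K)

lemma convex_lower_image: "convex (lower_image l B b P Y c)"
  unfolding lower_image_eq
  by (intro convex_set_plus convex_linear_image linear_dual_obj convex_dual_feasible convex_convex_cone_hull)

text \<open>Vertical shifts preserve w(t), and \<open>wvec\<close> recovers \<open>w\<close> from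
  the objective vector. So a feasible pair whose objective vector lies above \<open>t\<close> must
  have \<open>wvec l c t\<close> as its \<open>w\<close>, and only \<open>u\<close> remains to be
  chosen.\<close>

lemma mem_lower_image:
  "t \<in> lower_image l B b P Y c \<longleftrightarrow> (\<exists>u. (u, wvec l c t) \<in> dual_feasible B P Y c \<and> t $ l \<le> b \<bullet> u)"
proof
  assume "t \<in> lower_image l B b P Y c"
  then obtain r u w where r: "0 \<le> r" "t + r *\<^sub>R axis l 1 = dual_obj l b (u, w)"
    and uw: "(u, w) \<in> dual_feasible B P Y c"
    unfolding lower_image_eq mem_plus_neg_axis by force
  have "c \<bullet> w = 1"
    using uw by (simp add: dual_feasible_iff)
  then have "wvec l c t = w"
    using arg_cong [OF r(2), of "wvec l c"] by (simp add: wvec_add_axis wvec_dual_obj c_last)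
  moreover have "t $ l + r = b \<bullet> u"
    using arg_cong [OF r(2), of "\<lambda>x. x $ l"] by (simp add: dual_obj_nth_last)
  ultimately show "\<exists>u. (u, wvec l c t) \<in> dual_feasible B P Y c \<and> t $ l \<le> b \<bullet> u"
    using uw r(1) by (intro exI [of _ u]) simp
next
  assume "\<exists>u. (u, wvec l c t) \<in> dual_feasible B P Y c \<and> t $ l \<le> b \<bullet> u"
  then obtain u where u: "(u, wvec l c t) \<in> dual_feasible B P Y c" "t $ l \<le> b \<bullet> u"
    by auto
  then show "t \<in> lower_image l B b P Y c"
    unfolding lower_image_eq mem_plus_neg_axis
    by (intro exI [of _ "b \<bullet> u - t $ l"]) (simp flip: dual_obj_wvec [OF c_last])
qed

lemma lower_image_downward:
  "lower_image l B b P Y c + convex_cone hull {- axis l 1} \<subseteq> lower_image l B b P Y c"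
proof
  fix t assume "t \<in> lower_image l B b P Y c + convex_cone hull {- axis l 1}"
  then show "t \<in> lower_image l B b P Y c"
    unfolding mem_plus_neg_axis mem_lower_image by (force simp: wvec_add_axis c_last)
qed

lemma lower_image_subset_dual_polyhedron:
  assumes "V \<noteq> {}" "V \<subseteq> upper_image B b P C"
  shows "lower_image l B b P Y c \<subseteq> dual_polyhedron l c (convex hull V + K)"
proof
  fix t assume "t \<in> lower_image l B b P Y c"
  then obtain u where u: "(u, wvec l c t) \<in> dual_feasible B P Y c" "t $ l \<le> b \<bullet> u"
    unfolding mem_lower_image by auto
  then have "t $ l \<le> wvec l c t \<bullet> v" if "v \<in> V" for v
    using dual_le_primal [OF u(1), of v] that assms(2) by auto
  with u(1) show "t \<in> dual_polyhedron l c (convex hull V + K)"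
    unfolding dual_polyhedron_iff [OF assms(1)] dual_feasible_iff by blast
qed

text \<open>A normal separating \<open>y\<close> from the inner approximation is nonnegative on
  \<open>K\<close>, hence positive at \<open>c\<close>, and can be normalized to some w(t) with
  \<open>t\<close> in the dual. As \<open>t\<close> is in the lower image, a dual feasible
  \<open>u\<close> reaches the separating level, against weak duality at \<open>y\<close>.\<close>

lemma upper_image_subset_inner:
  assumes V: "finite V" "V \<noteq> {}"
    and dual: "dual_polyhedron l c (convex hull V + K) \<subseteq> lower_image l B b P Y c"
  shows "upper_image B b P C \<subseteq> convex hull V + K"
proof
  fix y assume y: "y \<in> upper_image B b P C"
  show "y \<in> convex hull V + K"
  proof (rule ccontr)
    assume "y \<notin> convex hull V + K"
    moreover have "convex (convex hull V + K)"
      by (intro convex_set_plus convex_convex_hull convex_convex_cone_hull)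
    moreover have "closed (convex hull V + K)"
      by (intro closed_set_plus_compact closed_convex_cone_hull finite_Td finite_imp_compact_convex_hull V)
    ultimately obtain a r where a: "a \<bullet> y < r" "\<forall>x\<in>convex hull V + K. r < a \<bullet> x"
      using separating_hyperplane_closed_point by blast
    then have "\<forall>x\<in>convex hull V + K. r \<le> a \<bullet> x"
      by (simp add: less_imp_le)
    then have aV: "\<forall>v\<in>V. r \<le> a \<bullet> v" and aK: "\<forall>k\<in>K. 0 \<le> a \<bullet> k"
      unfolding hull_plus_cone_halfspace_iff [OF convex_cone_K V(2)] by auto
    have "a \<noteq> 0"
    proof
      assume "a = 0"
      moreover obtain v where "v \<in> V" using V(2) by auto
      ultimately show False using a(1) aV by force
    qed
    obtain \<epsilon> where "\<epsilon> > 0" "\<epsilon> * norm a \<le> c \<bullet> a"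
      using inner_c_pos aK by auto
    moreover from this have "0 < \<epsilon> * norm a"
      using \<open>a \<noteq> 0\<close> by simp
    ultimately have pos: "0 < c \<bullet> a" by simp
    define w where "w = (1 / (c \<bullet> a)) *\<^sub>R a"
    define \<rho> where "\<rho> = r / (c \<bullet> a)"
    \<comment> \<open>The shift puts the separating level \<rho> into the last coordinate and keeps
      w(t) = w.\<close>
    define t where "t = w + (\<rho> - w $ l) *\<^sub>R axis l 1"
    have "c \<bullet> w = 1"
      using pos by (simp add: w_def)
    then have wt: "wvec l c t = w" and tl: "t $ l = \<rho>"
      by (simp_all add: t_def wvec_add_axis c_last wvec_eq [of c l w])
    have "t \<in> dual_polyhedron l c (convex hull V + K)"
      unfolding dual_polyhedron_iff [OF V(2)] wt tl
      using aV aK pos by (simp add: w_def \<rho>_def divide_right_mono)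
    then have "t \<in> lower_image l B b P Y c"
      using dual by blast
    then obtain u where u: "(u, w) \<in> dual_feasible B P Y c" "\<rho> \<le> b \<bullet> u"
      unfolding mem_lower_image wt tl by auto
    have "\<rho> \<le> w \<bullet> y"
      using dual_le_primal [OF u(1) y] u(2) by simp
    then show False
      using a(1) pos by (simp add: w_def \<rho>_def divide_le_cancel)
  qed
qed

text \<open>If P x = P x' + z with z a nonzero element of \<open>C\<close>, then P x is the midpoint
  of P x' and P x' + 2z, both in the upper image.\<close>

lemma extreme_point_imp_minimizer:
  assumes x: "x \<in> feasible B b" and ext: "(P *v x) extreme_point_of upper_image B b P C"
  shows "point_minimizer B b P C x"
  unfolding point_minimizer_def
proof (intro conjI notI x)
  assume "\<exists>x'\<in>feasible B b. cone_le C (P *v x') (P *v x) \<and> P *v x' \<noteq> P *v x"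
  then obtain x' z where x': "x' \<in> feasible B b" and z: "z \<in> C" "z \<noteq> 0" "P *v x = P *v x' + z"
    by (auto simp: cone_le_def)
  have "P *v x' + 2 *\<^sub>R z \<in> upper_image B b P C"
    using z C_subset_K x' by (intro upper_image_add_K image_in_upper_image convex_cone_hull_mul) auto
  moreover have "P *v x \<in> open_segment (P *v x') (P *v x' + 2 *\<^sub>R z)"
    unfolding in_segment
  proof (intro conjI exI [of _ "1/2"])
    show "P *v x = (1 - 1 / 2) *\<^sub>R (P *v x') + (1 / 2) *\<^sub>R (P *v x' + 2 *\<^sub>R z)"
      by (simp add: z(3) algebra_simps flip: scaleR_add_left)
  qed (use z(2) in auto)
  ultimately show False
    using ext image_in_upper_image [OF x'] by (auto simp: extreme_point_of_def)
qed

text \<open>A dominating point differs only in the last coordinate of the objective, hence has the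
  same \<open>w\<close>; it would be a better solution of the same linear program.\<close>

lemma dual_optimal_imp_maximizer:
  assumes t: "(u, w) \<in> dual_feasible B P Y c" and opt: "opt_D1 B b P w u"
  shows "dual_maximizer l B b P Y c (u, w)"
  unfolding dual_maximizer_def
proof (intro conjI notI t)
  assume "\<exists>t'\<in>dual_feasible B P Y c.
    cone_le (dual_cone_K l) (dual_obj l b (u, w)) (dual_obj l b t') \<and>
    dual_obj l b t' \<noteq> dual_obj l b (u, w)"
  then obtain u' w' r where t': "(u', w') \<in> dual_feasible B P Y c" and r: "0 \<le> r"
    and eq: "dual_obj l b (u', w') - dual_obj l b (u, w) = r *\<^sub>R axis l 1"
    and ne: "dual_obj l b (u', w') \<noteq> dual_obj l b (u, w)"
    unfolding cone_le_def dual_cone_K_def by auto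
  have eq': "dual_obj l b (u', w') = dual_obj l b (u, w) + r *\<^sub>R axis l 1"
    using eq by (simp add: algebra_simps)
  have cw: "c \<bullet> w = 1" "c \<bullet> w' = 1"
    using t t' by (auto simp: dual_feasible_iff)
  have "w' = w"
    using arg_cong [OF eq', of "wvec l c"] by (simp add: wvec_add_axis wvec_dual_obj c_last cw)
  moreover have "b \<bullet> u' = b \<bullet> u + r"
    using arg_cong [OF eq', of "\<lambda>x. x $ l"] by (simp add: dual_obj_nth_last)
  moreover have "b \<bullet> u' \<le> b \<bullet> u"
    using opt t' \<open>w' = w\<close> unfolding opt_D1_def dual_feasible_iff by blast
  ultimately show False
    using r ne eq' by simp
qed

text \<open>The hypotheses on \<open>Tb\<close> describe the end of a pass without improvement: each
  point of \<open>Tsp\<close> has left a pair whose value reaches its last coordinate, and all pairs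
  stem from optimal solutions for points of \<open>Tsp\<close>.\<close>

lemma correct_at_termination:
  assumes S: "finite S" "S \<noteq> {}" "S \<subseteq> feasible B b"
    and Tsp: "dual_result l c ((\<lambda>x. P *v x) ` S) Td Tsp"
    and Tb: "finite Tb"
      "\<And>t. t \<in> Tsp \<Longrightarrow> \<exists>u. (u, wvec l c t) \<in> Tb \<and> t $ l \<le> b \<bullet> u"
      "\<And>p. p \<in> Tb \<Longrightarrow> \<exists>t\<in>Tsp. \<exists>u. p = (u, wvec l c t) \<and> opt_D1 B b P (wvec l c t) u"
  shows "primal_solution B b P C
      {x \<in> S. (P *v x) extreme_point_of (convex hull ((\<lambda>x. P *v x) ` S) + K)} Sh" (is ?primal)
    and "dual_solution l B b P Y c Tb" (is ?dual)
    and "is_vrep (upper_image B b P C) ((\<lambda>x. P *v x) ` S) Td" (is ?upper)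
    and "is_vrep (lower_image l B b P Y c) Tsp {- axis l 1}" (is ?lower)
proof -
  let ?V = "(\<lambda>x. P *v x) ` S"
  let ?T = "dual_polyhedron l c (convex hull ?V + K)"
  let ?L = "lower_image l B b P Y c"
  let ?N = "convex_cone hull {- axis l 1 :: real^'q}"
  have V: "finite ?V" "?V \<noteq> {}" "?V \<subseteq> upper_image B b P C"
    using S image_in_upper_image by auto
  have vrep: "?T = convex hull Tsp + ?N" "finite Tsp"
    using dual_result_vrep [OF V(2) Tsp] by (auto simp: is_vrep_def)
  have feas: "p \<in> dual_feasible B P Y c" if p: "p \<in> Tb" for p
  proof -
    obtain t u where t: "t \<in> Tsp" "p = (u, wvec l c t)" "opt_D1 B b P (wvec l c t) u"
      using Tb(3) [OF p] by auto
    have "t \<in> ?T"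
      using dual_result_subset [OF Tsp] t(1) by auto
    then have "\<forall>k\<in>K. 0 \<le> wvec l c t \<bullet> k"
      unfolding dual_polyhedron_iff [OF V(2)] by auto
    with t show ?thesis
      unfolding t(2) dual_feasible_iff by (simp add: opt_D1_def inner_wvec c_last)
  qed
  have "Tsp \<subseteq> ?L"
    unfolding subset_iff mem_lower_image using Tb(2) feas by blast
  then have "convex hull Tsp \<subseteq> ?L"
    by (intro hull_minimal convex_lower_image)
  then have T_L: "?T \<subseteq> ?L"
    unfolding vrep using lower_image_downward by (meson order_refl order_trans set_plus_mono2)
  have T_eq: "?T = ?L"
    using T_L lower_image_subset_dual_polyhedron [OF V(2,3)] by (rule equalityI)
  show ?lower
    using vrep T_eq by (simp add: is_vrep_def)
  have "convex hull ?V \<subseteq> upper_image B b P C"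
    using V(3) convex_upper_image by (rule hull_minimal)
  then have "convex hull ?V + K \<subseteq> upper_image B b P C"
    using upper_image_add_K by (force simp: set_plus_def)
  with upper_image_subset_inner [OF V(1,2) T_L] have U_eq: "upper_image B b P C = convex hull ?V + K"
    by (rule equalityI)
  then show ?upper
    using V(1) finite_Td by (simp add: is_vrep_def)
  show ?dual
    unfolding dual_solution_def finite_supremizer_def minkowski_diff_K
  proof (intro conjI ballI)
    let ?A = "convex hull (dual_obj l b ` Tb) + ?N"
    \<comment> \<open>Dual feasibility does not involve \<open>b\<close>, so the homogeneous input
      solution supplies a feasible point and the lower image is nonempty.\<close>
    have "Tsp \<noteq> {}"
    proof
      assume "Tsp = {}"
      then have "?T = {}"
        unfolding vrep by (simp add: set_plus_def)
      moreover obtain p where "p \<in> dual_feasible B P Y c"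
        using input_dual by (auto simp: dual_solution_def finite_supremizer_def)
      ultimately show False
        unfolding T_eq lower_image_def minkowski_diff_def dual_cone_K_def by force
    qed
    then show "Tb \<noteq> {}"
      using Tb(2) by blast
    show "finite Tb" by fact
    show "Tb \<subseteq> dual_feasible B P Y c"
      using feas by auto
    show "dual_maximizer l B b P Y c p" if "p \<in> Tb" for p
      using Tb(3) [OF that] feas [OF that] dual_optimal_imp_maximizer by auto
    show "?A = ?L"
    proof
      have "dual_obj l b ` Tb \<subseteq> ?L"
        unfolding lower_image_eq using feas set_plus_intro [of _ _ 0 ?N]
        by (force simp: convex_cone_hull_contains_0)
      then have "convex hull (dual_obj l b ` Tb) \<subseteq> ?L"
        by (intro hull_minimal convex_lower_image)
      then show "?A \<subseteq> ?L"
        using lower_image_downward by (meson order_refl order_trans set_plus_mono2)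
      \<comment> \<open>Each \<open>t\<close> lies vertically below the objective vector of the pair
        kept for it.\<close>
      have "Tsp \<subseteq> ?A"
      proof
        fix t assume "t \<in> Tsp"
        then obtain u where u: "(u, wvec l c t) \<in> Tb" "t $ l \<le> b \<bullet> u"
          using Tb(2) by auto
        then have "t + (b \<bullet> u - t $ l) *\<^sub>R axis l 1 \<in> convex hull (dual_obj l b ` Tb)"
          unfolding dual_obj_wvec [OF c_last, symmetric] by (intro hull_inc imageI)
        with u(2) show "t \<in> ?A"
          unfolding mem_plus_neg_axis by (intro exI [of _ "b \<bullet> u - t $ l"]) simp
      qed
      moreover have "convex ?A"
        by (intro convex_set_plus convex_convex_hull convex_convex_cone_hull)
      ultimately have "convex hull Tsp + ?N \<subseteq> ?A + ?N"
        by (intro set_plus_mono2 hull_minimal [of Tsp] order_refl)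
      also have "?A + ?N = convex hull (dual_obj l b ` Tb) + (?N + ?N)"
        by (simp add: add.assoc)
      also have "?N + ?N = ?N"
        by (simp flip: convex_cone_hull_Un_set_plus)
      finally show "?L \<subseteq> ?A"
        unfolding vrep T_eq [symmetric] .
    qed
  qed
  \<comment> \<open>Every element of \<open>S\<close> mapped into \<open>W\<close> survives the
    deletion, so the remaining points still generate the upper image.\<close>
  obtain W where W: "W \<subseteq> ?V" "convex hull W + K = convex hull ?V + K"
    "\<And>v. v \<in> W \<Longrightarrow> v extreme_point_of (convex hull ?V + K)"
    using extreme_points_generate [OF V(1) convex_cone_K K_pointed] by blast
  let ?S = "{x \<in> S. (P *v x) extreme_point_of (convex hull ?V + K)}"
  have "W \<subseteq> (\<lambda>x. P *v x) ` ?S"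
    using W(1,3) by blast
  then have "convex hull ?V + K \<subseteq> convex hull ((\<lambda>x. P *v x) ` ?S) + K"
    unfolding W(2) [symmetric] by (intro set_plus_mono2 hull_mono) auto
  moreover have "convex hull ((\<lambda>x. P *v x) ` ?S) + K \<subseteq> convex hull ?V + K"
    by (intro set_plus_mono2 hull_mono) auto
  ultimately have gen: "convex hull ((\<lambda>x. P *v x) ` ?S) + K = upper_image B b P C"
    unfolding U_eq by blast
  have "?S \<noteq> {}"
  proof
    assume "?S = {}"
    with gen have "upper_image B b P C = {}"
      by (simp only: image_empty convex_hull_empty) (simp add: set_plus_def)
    with V(2,3) show False by blast
  qed
  moreover have "K = convex_cone hull ((\<lambda>x. P *v x) ` Sh) + C"
    by (simp add: T_dirs_def convex_cone_hull_Un_set_plus Y_gen)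
  then have "convex hull ((\<lambda>x. P *v x) ` ?S) + convex_cone hull ((\<lambda>x. P *v x) ` Sh) + C
      = upper_image B b P C"
    using gen by (simp add: add.assoc)
  moreover have "point_minimizer B b P C x" if "x \<in> ?S" for x
    using that S(3) unfolding U_eq [symmetric] by (intro extreme_point_imp_minimizer) auto
  ultimately show ?primal
    using S input_primal unfolding primal_solution_def finite_infimizer_def by auto
qed

subsection \<open>Invariant and termination\<close>

definition approx_solution :: "(real^'n) set \<Rightarrow> bool" where
  "approx_solution S \<longleftrightarrow> finite S \<and> S \<noteq> {} \<and> S \<subseteq> feasible B b"

text \<open>An improvement detaches \<open>Tp\<close> from \<open>S\<close>, and the next pass
  resets \<open>Tb\<close>. So what is needed for the final correctness is demanded only while
  \<open>flag\<close> is false; the rest keeps \<open>solve\<close> applicable to the remaining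
  list.\<close>

primrec alg_inv ::
  "(real^'n, (real^'m) \<times> (real^'q), real^'q) alg_state \<Rightarrow> bool"
where
  "alg_inv Init \<longleftrightarrow> True"
| "alg_inv (Pass S) \<longleftrightarrow> approx_solution S"
| "alg_inv (Loop S Tb Tp Tsp ts flag) \<longleftrightarrow>
    approx_solution S \<and> Tp \<noteq> {} \<and> dual_result l c Tp Td Tsp \<and> set ts \<subseteq> Tsp \<and>
    (\<not> flag \<longrightarrow> Tp = (\<lambda>x. P *v x) ` S \<and> finite Tb \<and>
      (\<forall>t \<in> Tsp - set ts. \<exists>u. (u, wvec l c t) \<in> Tb \<and> t $ l \<le> b \<bullet> u) \<and>
      (\<forall>p\<in>Tb. \<exists>t\<in>Tsp. \<exists>u. p = (u, wvec l c t) \<and> opt_D1 B b P (wvec l c t) u))"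
| "alg_inv (Done S Tb Tp Tsp) \<longleftrightarrow>
    primal_solution B b P C S Sh \<and> dual_solution l B b P Y c Tb \<and>
    is_vrep (upper_image B b P C) Tp Td \<and> is_vrep (lower_image l B b P Y c) Tsp {- axis l 1}"

text \<open>A face met by \<open>S\<close> stays met when \<open>S\<close> grows, and any point that
  \<open>solve\<close> may return meets the optimal face, be it a vertex or not. The empty face is
  always counted, which does no harm.\<close>

definition missed_faces :: "(real^'n) set \<Rightarrow> (real^'n) set set" where
  "missed_faces S = {F. F face_of feasible B b \<and> F \<inter> S = {}}"

text \<open>Along a constant set of missed faces, a run goes from an improved for-loop through \<open>Pass\<close> to a
  not yet improved for-loop, whence the phases 3, 2, 1.\<close>

primrec alg_rank ::
  "(real^'n, (real^'m) \<times> (real^'q), real^'q) alg_state \<Rightarrow> nat \<times> nat \<times> nat"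
where
  "alg_rank Init = (Suc (card {F. F face_of feasible B b}), 0, 0)"
| "alg_rank (Pass S) = (card (missed_faces S), 2, 0)"
| "alg_rank (Loop S Tb Tp Tsp ts flag) =
    (card (missed_faces S), if flag then 3 else 1, length ts)"
| "alg_rank (Done S Tb Tp Tsp) = (0, 0, 0)"

abbreviation less_rank :: "((nat \<times> nat \<times> nat) \<times> (nat \<times> nat \<times> nat)) set" where
  "less_rank \<equiv> less_than <*lex*> less_than <*lex*> less_than"

lemma finite_faces: "finite {F. F face_of feasible B b}"
  by (rule finite_polyhedron_faces [OF polyhedron_feasible])

lemma finite_missed_faces: "finite (missed_faces S)"
  using finite_faces by (rule rev_finite_subset) (auto simp: missed_faces_def)

lemma missed_faces_insert: "card (missed_faces (insert x S)) \<le> card (missed_faces S)"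
  by (intro card_mono finite_missed_faces) (auto simp: missed_faces_def)

lemma missed_faces_improve:
  assumes x: "opt_P1 B b P w x" and S: "\<And>x'. x' \<in> S \<Longrightarrow> w \<bullet> (P *v x) < w \<bullet> (P *v x')"
  shows "card (missed_faces (insert x S)) < card (missed_faces S)"
proof (intro psubset_card_mono finite_missed_faces psubsetI)
  let ?F = "feasible B b \<inter> {y. (transpose P *v w) \<bullet> y = w \<bullet> (P *v x)}"
  have "?F face_of feasible B b"
    using x by (intro face_of_Int_supporting_hyperplane_ge polyhedron_imp_convex polyhedron_feasible)
      (simp add: inner_transpose opt_P1_def del: transpose_matrix_vector)
  moreover have "?F \<inter> S = {}"
    using S by (fastforce simp: inner_transpose simp del: transpose_matrix_vector)
  ultimately have "?F \<in> missed_faces S"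
    by (simp add: missed_faces_def)
  moreover have "x \<in> ?F"
    using x by (simp add: inner_transpose opt_P1_def del: transpose_matrix_vector)
  then have "?F \<notin> missed_faces (insert x S)"
    unfolding missed_faces_def by blast
  ultimately show "missed_faces (insert x S) \<noteq> missed_faces S"
    by metis
qed (auto simp: missed_faces_def)

lemma dual_result_point:
  assumes "V \<noteq> {}" "dual_result l c V Td W" "t \<in> W"
  shows "v \<in> V \<Longrightarrow> t $ l \<le> wvec l c t \<bullet> v" and "\<forall>k\<in>K. 0 \<le> wvec l c t \<bullet> k"
  using subsetD [OF dual_result_subset [OF assms(2)] assms(3)]
  by (auto simp: dual_polyhedron_iff [OF assms(1)])

lemma alg_step_inv:
  assumes "alg2_step brk l B b P Y c Sh Th s s'" "alg_inv s"
  shows "alg_inv s'"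
  using assms
proof cases
  case (init x)
  then show ?thesis by (simp add: approx_solution_def opt_P1_def)
next
  case (begin_pass S Tsp ts)
  with assms(2) show ?thesis by (simp add: approx_solution_def)
next
  case (improve t x u S Tb Tp Tsp ts flag)
  with assms(2) show ?thesis by (simp add: approx_solution_def opt_P1_def)
next
  case (keep t x u S Tb Tp Tsp ts flag)
  let ?Tb = "insert (u, wvec l c t) Tb"
  have inv: "alg_inv (Loop S Tb Tp Tsp (t # ts) flag)"
    using assms(2) keep(1) by simp
  have "\<exists>u'. (u', wvec l c t') \<in> ?Tb \<and> t' $ l \<le> b \<bullet> u'"
    if "\<not> flag" "t' \<in> Tsp - set ts" for t'
  proof (cases "t' = t")
    case True
    with keep(5) show ?thesis by (intro exI [of _ u]) simp
  next
    case False
    with inv that have "\<exists>u'. (u', wvec l c t') \<in> Tb \<and> t' $ l \<le> b \<bullet> u'" by simp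
    then show ?thesis by blast
  qed
  moreover have "\<exists>t'\<in>Tsp. \<exists>u'. p = (u', wvec l c t') \<and> opt_D1 B b P (wvec l c t') u'"
    if "\<not> flag" "p \<in> ?Tb" for p
  proof (cases "p = (u, wvec l c t)")
    case True
    with inv keep(4) show ?thesis by (intro bexI [of _ t]) auto
  next
    case False
    with inv that show ?thesis by simp
  qed
  ultimately show ?thesis
    using inv unfolding keep(2) alg_inv.simps by simp
next
  case (repeat_pass S Tb Tp Tsp)
  with assms(2) show ?thesis by simp
next
  case (finish S Tb Tp Tsp)
  \<comment> \<open>With an empty list the invariant covers all of \<open>Tsp\<close>, and the false
    flag guarantees that \<open>Tp\<close> is the image of the current \<open>S\<close>.\<close>
  with assms(2) have "finite S" "S \<noteq> {}" "S \<subseteq> feasible B b" and Tp: "Tp = (\<lambda>x. P *v x) ` S"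
    and "dual_result l c ((\<lambda>x. P *v x) ` S) Td Tsp" "finite Tb"
    and "\<And>t. t \<in> Tsp \<Longrightarrow> \<exists>u. (u, wvec l c t) \<in> Tb \<and> t $ l \<le> b \<bullet> u"
    and "\<And>p. p \<in> Tb \<Longrightarrow> \<exists>t\<in>Tsp. \<exists>u. p = (u, wvec l c t) \<and> opt_D1 B b P (wvec l c t) u"
    by (auto simp: approx_solution_def)
  from correct_at_termination [OF this(1-3,5-8)] show ?thesis
    unfolding finish Tp by simp
qed

lemma alg_step_rank:
  assumes "alg2_step brk l B b P Y c Sh Th s s'" "alg_inv s"
  shows "(alg_rank s', alg_rank s) \<in> less_rank"
  using assms
proof cases
  case (init x)
  \<comment> \<open>The \<open>Suc\<close> in the initial rank makes the first component drop even
    if \<open>x\<close> were to meet no face beyond those already excluded by this weak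
    bound.\<close>
  have "card (missed_faces {x}) \<le> card {F. F face_of feasible B b}"
    by (intro card_mono finite_faces) (auto simp: missed_faces_def)
  with init show ?thesis by simp
next
  case (begin_pass S Tsp ts)
  then show ?thesis by simp
next
  case (improve t x u S Tb Tp Tsp ts flag)
  \<comment> \<open>With \<open>flag\<close> already set, \<open>x\<close> need not be new: the
    first component may stay equal, and the list shrinks, also when the break empties it. The first
    improvement raises the phase from 1 to 3, so there the missed faces must strictly
    decrease.\<close>
  show ?thesis
  proof (cases flag)
    case True
    with improve show ?thesis
      using missed_faces_insert [of x S] by (auto simp: le_less)
  next
    case False
    with assms(2) improve have S: "(\<lambda>x. P *v x) ` S \<noteq> {}" "dual_result l c ((\<lambda>x. P *v x) ` S) Td Tsp"
      "t \<in> Tsp"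
      by auto
    have "wvec l c t \<bullet> (P *v x) < t $ l"
      using opt_P1_D1_values_eq [OF improve(3,4)] improve(5) by simp
    then have "wvec l c t \<bullet> (P *v x) < wvec l c t \<bullet> (P *v x')" if "x' \<in> S" for x'
      using dual_result_point(1) [OF S, of "P *v x'"] that by force
    then have "card (missed_faces (insert x S)) < card (missed_faces S)"
      by (intro missed_faces_improve [OF improve(3)])
    with improve show ?thesis by simp
  qed
next
  case (keep t x u S Tb Tp Tsp ts flag)
  then show ?thesis by simp
next
  case (repeat_pass S Tb Tp Tsp)
  then show ?thesis by simp
next
  case (finish S Tb Tp Tsp)
  then show ?thesis by auto
qed

text \<open>Points of \<open>Tsp\<close> lie in the dual polyhedron, so w(t) is nonnegative on
  \<open>K\<close> and both linear programs are solvable; \<open>dual\<close> succeeds because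
  \<open>S\<close> is finite and nonempty.\<close>

lemma alg_step_exists:
  assumes "alg_inv s"
  shows "(\<exists>s'. alg2_step brk l B b P Y c Sh Th s s') \<or> (\<exists>S Tb Tp Tsp. s = Done S Tb Tp Tsp)"
proof (cases s)
  case Init
  then show ?thesis
    using solve_mean_exists alg2_step.init by metis
next
  case (Pass S)
  with assms obtain W where W: "dual_result l c ((\<lambda>x. P *v x) ` S) Td W" "finite W"
    using dual_result_exists [of "(\<lambda>x. P *v x) ` S"] by (auto simp: approx_solution_def)
  obtain ts where "distinct ts" "set ts = W"
    using finite_distinct_list [OF W(2)] by auto
  with W(1) Pass show ?thesis
    using alg2_step.begin_pass by blast
next
  case (Loop S Tb Tp Tsp ts flag)
  show ?thesis
  proof (cases ts)
    case Nil
    show ?thesis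
    proof (cases flag)
      case True
      show ?thesis
        unfolding Loop Nil using True by (simp only:) (intro disjI1 exI, rule alg2_step.repeat_pass)
    next
      case False
      show ?thesis
        unfolding Loop Nil using False by (simp only:) (intro disjI1 exI, rule alg2_step.finish)
    qed
  next
    case (Cons t ts')
    with assms Loop have "\<forall>k\<in>K. 0 \<le> wvec l c t \<bullet> k"
      by (intro dual_result_point(2) [of Tp Tsp]) auto
    then obtain x u where xu: "opt_P1 B b P (wvec l c t) x" "opt_D1 B b P (wvec l c t) u"
      by (rule solve_exists)
    show ?thesis
      unfolding Loop Cons
      by (cases "t $ l - b \<bullet> u > 0")
        ((intro disjI1 exI, erule alg2_step.improve [OF xu]),
          (intro disjI1 exI, erule alg2_step.keep [OF xu]))
  qed
next
  case (Done S Tb Tp Tsp)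
  then show ?thesis by blast
qed

end

text \<open>For a nondeterministic system, finiteness means that no choices give an infinite run,
  and executability that no reachable state other than \<open>Done\<close> is stuck. Together they
  force every maximal run to end in \<open>Done\<close>.\<close>

theorem theorem4p9:
  fixes B :: "real^'n^'m" and b :: "real^'m" and P :: "real^'n^'q" and Y :: "real^'p^'q"
    and C :: "(real^'q) set" and c :: "real^'q" and l :: 'q
    and Sh :: "(real^'n) set" and Th :: "((real^'m) \<times> (real^'q)) set" and brk :: bool
  assumes C_cone: "polyhedron C" "convex C" "cone C"
    and C_solid: "interior C \<noteq> {}"
    and C_pointed: "\<not> contains_line C"
    and Y_gen: "C = convex_cone hull (columns Y)"
    and c_int: "c \<in> interior C" and c_last: "c $ l = 1"
    and S_nonempty: "feasible B b \<noteq> {}"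
    and vertex: "\<exists>v. v extreme_point_of (upper_image B 0 P C)"
    and input_primal: "primal_solution B 0 P C {0} Sh"
    and input_dual: "dual_solution l B 0 P Y c Th"
  defines "step \<equiv> alg2_step brk l B b P Y c Sh Th"
  shows "(\<forall>s. step\<^sup>*\<^sup>* Init s \<longrightarrow>
            (\<exists>s'. step s s') \<or> (\<exists>S Tb Tp Tsp. s = Done S Tb Tp Tsp)) \<and>
         \<not> (\<exists>run. run 0 = Init \<and> (\<forall>i::nat. step (run i) (run (Suc i)))) \<and>
         (\<forall>S Tb Tp Tsp. step\<^sup>*\<^sup>* Init (Done S Tb Tp Tsp) \<longrightarrow>
            primal_solution B b P C S Sh \<and>
            dual_solution l B b P Y c Tb \<and>
            is_vrep (upper_image B b P C) Tp (T_dirs P Y Sh) \<and>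
            is_vrep (lower_image l B b P Y c) Tsp {- axis l 1})"
proof -
  interpret vlp B b P Y C c l Sh Th
    by (rule vlp.intro) (rule assms)+
  have reach: "alg_inv s" if "step\<^sup>*\<^sup>* Init s" for s
    using that by induction (auto simp: step_def intro: alg_step_inv)
  have no_run: False if run: "run 0 = Init" "\<And>i. step (run i) (run (Suc i))" for run
  proof -
    have "alg_inv (run i)" for i
      by (induction i) (use run alg_step_inv in \<open>auto simp: step_def\<close>)
    then have "(alg_rank (run (Suc i)), alg_rank (run i)) \<in> less_rank" for i
      using run(2) unfolding step_def by (intro alg_step_rank)
    then have "\<exists>f. \<forall>i. (f (Suc i), f i) \<in> less_rank"
      by (intro exI [of _ "\<lambda>i. alg_rank (run i)"] allI)
    moreover have "wf less_rank"
      by (intro wf_lex_prod wf_less_than)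
    ultimately show False
      using wf_iff_no_infinite_down_chain by blast
  qed
  show ?thesis
  proof (intro conjI allI impI)
    fix s assume "step\<^sup>*\<^sup>* Init s"
    then show "(\<exists>s'. step s s') \<or> (\<exists>S Tb Tp Tsp. s = Done S Tb Tp Tsp)"
      unfolding step_def by (intro alg_step_exists reach [unfolded step_def])
  next
    show "\<not> (\<exists>run. run 0 = Init \<and> (\<forall>i::nat. step (run i) (run (Suc i))))"
      using no_run by blast
  qed (use reach in fastforce)+
qed

end
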